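(* Let $F$ be a strictly balanced graph with $k$ vertices and $l\ge 1$ edges, and let $a$ be the number of automorphisms of $F$. Let $c>0$ be a constant and suppose \[ p\sim c\,N^{-k/l}\,\frac{N}{N_1}\quad (n\to\infty). \] Then the number $X_F$ of copies of $F$ in $G_p$ converges in distribution to a Poisson random variable with parameter $\lambda=c^l/a$.
   Context: Throughout, $n$ ranges over positive integers divisible by $4$ and asymptotics are as $n\to\infty$. The complete distance graph $G=G(n,n/2,n/4)=(V,E)$ has vertex set $V=\{\mathbf{x}=(x_1,\dots,x_n)\in\{0,1\}^n : x_1+\dots+x_n=n/2\}$ and edge set $E=\{\{\mathbf{x},\mathbf{y}\}: \langle \mathbf{x},\mathbf{y}\rangle=n/4\}$ (Euclidean inner product). Let $N=|V|=\binom{n}{n/2}$ and $N_1=\binom{n/2}{n/4}^2$ (the common degree in $G$). The random distance graph $G_p$ is the random spanning subgraph of $G$ in which each edge of $G$ is kept independently with probability $p=p(n)$. A graph $F$ is strictly balanced if $e(H)/v(H)<e(F)/v(F)$ for every proper nonempty subgraph $H\subset F$. *)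

theory Defs
  imports "HOL-Probability.Probability"
begin

definition dg_V :: "nat \<Rightarrow> (nat \<Rightarrow> nat) set" where
  "dg_V n = {x. (\<forall>i. x i \<in> {0,1}) \<and> (\<forall>i\<ge>n. x i = 0) \<and> (\<Sum>i<n. x i) = n div 2}"

definition dg_inner :: "nat \<Rightarrow> (nat \<Rightarrow> nat) \<Rightarrow> (nat \<Rightarrow> nat) \<Rightarrow> nat" where
  "dg_inner n x y = (\<Sum>i<n. x i * y i)"

definition dg_E :: "nat \<Rightarrow> (nat \<Rightarrow> nat) set set" where
  "dg_E n = {{x, y} | x y. x \<in> dg_V n \<and> y \<in> dg_V n \<and> dg_inner n x y = n div 4}"

definition dg_N :: "nat \<Rightarrow> real" where
  "dg_N n = real (n choose (n div 2))"

definition dg_N1 :: "nat \<Rightarrow> real" where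
  "dg_N1 n = real (((n div 2) choose (n div 4)) ^ 2)"

definition G_p :: "nat \<Rightarrow> real \<Rightarrow> (nat \<Rightarrow> nat) set set pmf" where
  "G_p n p = map_pmf (\<lambda>\<omega>. {e \<in> dg_E n. \<omega> e}) (Pi_pmf (dg_E n) False (\<lambda>_. bernoulli_pmf p))"

definition simple_graph :: "'a set \<Rightarrow> 'a set set \<Rightarrow> bool" where
  "simple_graph VF EF \<longleftrightarrow> finite VF \<and> (\<forall>e\<in>EF. \<exists>x y. x \<noteq> y \<and> x \<in> VF \<and> y \<in> VF \<and> e = {x, y})"

definition subgraph :: "'a set \<Rightarrow> 'a set set \<Rightarrow> 'a set \<Rightarrow> 'a set set \<Rightarrow> bool" where
  "subgraph VH EH VF EF \<longleftrightarrow> VH \<subseteq> VF \<and> EH \<subseteq> EF \<and> (\<forall>e\<in>EH. e \<subseteq> VH)"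

definition strictly_balanced :: "'a set \<Rightarrow> 'a set set \<Rightarrow> bool" where
  "strictly_balanced VF EF \<longleftrightarrow>
     (\<forall>VH EH. subgraph VH EH VF EF \<and> (VH, EH) \<noteq> (VF, EF) \<and> VH \<noteq> {} \<longrightarrow>
        real (card EH) / real (card VH) < real (card EF) / real (card VF))"

definition automorphisms :: "'a set \<Rightarrow> 'a set set \<Rightarrow> ('a \<Rightarrow> 'a) set" where
  "automorphisms VF EF = {\<sigma> \<in> VF \<rightarrow>\<^sub>E VF. bij_betw \<sigma> VF VF \<and>
      (\<forall>x\<in>VF. \<forall>y\<in>VF. {x, y} \<in> EF \<longleftrightarrow> {\<sigma> x, \<sigma> y} \<in> EF)}"

definition copies :: "'a set \<Rightarrow> 'a set set \<Rightarrow> 'b set \<Rightarrow> 'b set set \<Rightarrow> ('b set \<times> 'b set set) set" where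
  "copies VF EF V E' = {(W, D). W \<subseteq> V \<and> D \<subseteq> E' \<and>
      (\<exists>\<phi>. bij_betw \<phi> VF W \<and> D = (\<lambda>e. \<phi> ` e) ` EF)}"

definition num_copies :: "'a set \<Rightarrow> 'a set set \<Rightarrow> 'b set \<Rightarrow> 'b set set \<Rightarrow> nat" where
  "num_copies VF EF V E' = card (copies VF EF V E')"

end

theory Submission
  imports Defs "HOL-Real_Asymp.Real_Asymp"
begin

text \<open>
  The binomial moment \<open>E (X choose r)\<close> is a sum over sets of \<open>r\<close> copies of \<open>F\<close>. The
  pairwise disjoint ones give \<open>(p\<^sup>l M)\<^sup>r / r!\<close> up to a negligible error, \<open>M\<close> being the
  number of copies in \<open>G\<close>; overlapping ones span \<open>v\<close> vertices and \<open>e\<close> edges with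
  \<open>k e > l v\<close>, and the trivial bound \<open>N\<^sup>v\<close> for their number already makes them negligible
  because \<open>N / N\<^sub>1\<close> is only polylogarithmic in \<open>N\<close>. Bonferroni's inequalities turn
  convergence of these moments into convergence of the distribution.

  It remains to see that \<open>F\<close> has about \<open>N\<^sup>k (N\<^sub>1 / N)\<^sup>l\<close> homomorphisms into \<open>G\<close>. Written in
  signs, such a homomorphism is a sequence of \<open>n\<close> points of the cube \<open>{-1, 1}\<^sup>k\<close> on which the sums
  of all characters \<open>u\<^sub>v\<close> (vertices \<open>v\<close>) and \<open>u\<^sub>a u\<^sub>b\<close> (edges \<open>ab\<close>) vanish. Those characters are
  orthogonal, so a local central limit theorem, proved by Fourier inversion over a box, gives a limit
  that factorises over vertices and edges.
\<close>

section \<open>Poisson limits from binomial moments\<close>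

text \<open>The obstacle in the Fourier step is that \<open>Psi\<close>, the characteristic function
  of the vector of characters, has modulus 1 away from the origin as well: at
  \<open>t {v} = pi\<close>, or, for an edge \<open>{a, b}\<close>, at
  \<open>t {a} = t {b} = t {a, b} = pi / 2\<close> (other entries 0). These peaks reflect the
  lattice in which the sums of characters live. Since \<open>4 dvd n\<close>, vertex sums are even,
  and edge sums are multiples of 4 once the vertex sums vanish; so a box of half-sides
  \<open>pi / 2\<close> and \<open>pi / 4\<close> is large enough to test for zero. On this box a
  Gaussian bound for \<open>Psi\<close> holds everywhere, so one dominating function serves all
  \<open>n\<close> and no separate treatment of small and large frequencies is needed. Orthogonality
  makes the limiting Gaussian standard. It yields one factor \<open>sqrt (2 * pi)\<close> per
  frequency, and the asymptotics of \<open>N\<close> (vertex) and \<open>N1 / N\<close> (edge) yield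
  the same factors. In the moments, \<open>k e > l v\<close> is an inequality between integers, so
  it gains a full factor \<open>N powr (- 1 / l)\<close>; this beats every fixed power of
  \<open>N / N1\<close>.\<close>

lemma alternating_choose_partial_sum:
  "(\<Sum>s\<le>t. (-1) ^ s * real (y choose s)) = (if y = 0 then 1 else (-1) ^ t * real ((y - 1) choose t))"
proof (cases "y = 0")
  case True
  have "(\<Sum>s\<le>t. (-1) ^ s * real (0 choose s)) = (\<Sum>s\<in>{0}. (-1) ^ s * real (0 choose s))"
    by (rule sum.mono_neutral_right) (auto simp: binomial_eq_0)
  then show ?thesis using True by simp
next
  case False
  then have "(\<Sum>s\<le>t. (-1) ^ s * real (y choose s)) = (\<Sum>s\<le>t. (real y gchoose s) * (-1) ^ s)"
    by (intro sum.cong) (auto simp: binomial_gbinomial)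
  also have "\<dots> = (-1) ^ t * (real y - 1 gchoose t)"
    by (rule gbinomial_sum_lower_neg)
  also have "real y - 1 = real (y - 1)"
    using False by simp
  finally show ?thesis
    using False by (simp add: binomial_gbinomial)
qed

lemma choose_mult_shift: "real ((j + s) choose j) * real (x choose (j + s)) = real (x choose j) * real ((x - j) choose s)"
proof (cases "j + s \<le> x")
  case True
  then have "(x choose (j + s)) * ((j + s) choose j) = (x choose j) * ((x - j) choose (j + s - j))"
    by (intro choose_mult) auto
  then show ?thesis by (simp flip: of_nat_mult add: mult.commute)
next
  case False
  then have "x choose (j + s) = 0" "x < j \<or> x - j < s" by (auto simp: binomial_eq_0)
  then show ?thesis by (auto simp: binomial_eq_0)
qed

text \<open>Truncation of the inversion formula that recovers the probability of the value
  \<open>j\<close> from the binomial moments \<open>\<mu> r\<close>.\<close>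

definition bonferroni_sum :: "nat \<Rightarrow> nat \<Rightarrow> (nat \<Rightarrow> real) \<Rightarrow> real" where
  "bonferroni_sum t j \<mu> = (\<Sum>s\<le>t. (-1) ^ s * real ((j + s) choose j) * \<mu> (j + s))"

text \<open>For a single value \<open>x\<close> the truncation error has a sign that depends only on
  the parity of \<open>t\<close>; both Bonferroni inequalities are read off from this.\<close>

lemma bonferroni_sum_choose:
  "bonferroni_sum t j (\<lambda>r. real (x choose r)) =
     (if x = j then 1 else if x < j then 0 else (-1) ^ t * real (x choose j) * real ((x - j - 1) choose t))"
proof -
  have "bonferroni_sum t j (\<lambda>r. real (x choose r)) =
      real (x choose j) * (\<Sum>s\<le>t. (-1) ^ s * real ((x - j) choose s))"
    unfolding bonferroni_sum_def
    by (auto simp: sum_distrib_left choose_mult_shift mult.assoc mult.left_commute intro!: sum.cong)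
  then show ?thesis by (auto simp: alternating_choose_partial_sum binomial_eq_0)
qed

lemma indicator_le_bonferroni_sum:
  assumes "even t"
  shows "indicator {j} x \<le> bonferroni_sum t j (\<lambda>r. real (x choose r))"
  using assms by (auto simp: bonferroni_sum_choose indicator_def)

lemma bonferroni_sum_le_indicator:
  assumes "odd t"
  shows "bonferroni_sum t j (\<lambda>r. real (x choose r)) \<le> indicator {j} x"
  using assms by (auto simp: bonferroni_sum_choose indicator_def)

lemma expectation_bonferroni_sum:
  fixes q :: "nat pmf"
  assumes "finite (set_pmf q)"
  shows "measure_pmf.expectation q (\<lambda>x. bonferroni_sum t j (\<lambda>r. real (x choose r))) =
    bonferroni_sum t j (\<lambda>r. measure_pmf.expectation q (\<lambda>x. real (x choose r)))"
  unfolding bonferroni_sum_def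
  by (simp add: integrable_measure_pmf_finite assms)

text \<open>The numbers \<open>lam ^ r / fact r\<close> are the binomial moments of the Poisson law.
  With them the truncated sum factors into \<open>lam ^ j / fact j\<close> and a partial sum of the
  series of \<open>exp (- lam)\<close>.\<close>

lemma bonferroni_sum_poisson_tendsto:
  "(\<lambda>t. bonferroni_sum t j (\<lambda>r. lam ^ r / fact r)) \<longlonglongrightarrow> lam ^ j / fact j * exp (- lam)"
proof -
  have eq: "bonferroni_sum t j (\<lambda>r. lam ^ r / fact r) = lam ^ j / fact j * (\<Sum>s\<le>t. (- lam) ^ s / fact s)" for t
    unfolding bonferroni_sum_def sum_distrib_left
  proof (intro sum.cong refl)
    fix s
    have "real ((j + s) choose j) = fact (j + s) / (fact j * fact s)"
      by (simp add: binomial_fact)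
    then show "(-1) ^ s * real ((j + s) choose j) * (lam ^ (j + s) / fact (j + s)) =
        lam ^ j / fact j * ((- lam) ^ s / fact s)"
      by (simp add: power_add power_minus[of lam] field_simps)
  qed
  have "(\<lambda>s. (- lam) ^ s /\<^sub>R fact s) sums exp (- lam)"
    by (rule exp_converges)
  then have "(\<lambda>t. \<Sum>s\<le>t. (- lam) ^ s /\<^sub>R fact s) \<longlonglongrightarrow> exp (- lam)"
    by (simp add: sums_def_le)
  then show ?thesis
    unfolding eq by (intro tendsto_mult tendsto_const) (simp add: divide_inverse_commute)
qed

text \<open>The order of limits matters: a truncation level \<open>t\<close> is fixed first, so that
  only finitely many moments have to converge in \<open>m\<close>.\<close>

lemma pmf_tendsto_poisson:
  fixes q :: "nat \<Rightarrow> nat pmf"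
  assumes fin: "\<And>m. finite (set_pmf (q m))"
    and mom: "\<And>r. (\<lambda>m. measure_pmf.expectation (q m) (\<lambda>x. real (x choose r))) \<longlonglongrightarrow> lam ^ r / fact r"
  shows "(\<lambda>m. pmf (q m) j) \<longlonglongrightarrow> lam ^ j / fact j * exp (- lam)"
proof -
  let ?P = "lam ^ j / fact j * exp (- lam)"
  let ?L = "\<lambda>t. bonferroni_sum t j (\<lambda>r. lam ^ r / fact r)"
  let ?B = "\<lambda>t m. bonferroni_sum t j (\<lambda>r. measure_pmf.expectation (q m) (\<lambda>x. real (x choose r)))"
  have BL: "(\<lambda>m. ?B t m) \<longlonglongrightarrow> ?L t" for t
    unfolding bonferroni_sum_def by (intro tendsto_intros mom)
  have pmf_eq: "pmf (q m) j = measure_pmf.expectation (q m) (indicator {j})" for m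
    by (simp add: measure_pmf_single)
  have up: "pmf (q m) j \<le> ?B t m" if "even t" for t m
    unfolding pmf_eq expectation_bonferroni_sum[OF fin, symmetric]
    by (intro integral_mono integrable_measure_pmf_finite fin indicator_le_bonferroni_sum that)
  have lo: "?B t m \<le> pmf (q m) j" if "odd t" for t m
    unfolding pmf_eq expectation_bonferroni_sum[OF fin, symmetric]
    by (intro integral_mono integrable_measure_pmf_finite fin bonferroni_sum_le_indicator that)
  note LP = bonferroni_sum_poisson_tendsto[of j lam]
  show ?thesis
  proof (rule order_tendstoI)
    fix a assume "a < ?P"
    then have "eventually (\<lambda>t. a < ?L t) sequentially"
      using LP by (rule order_tendstoD(1)[rotated])
    then obtain t0 where "\<And>t. t \<ge> t0 \<Longrightarrow> a < ?L t" by (auto simp: eventually_sequentially)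
    \<comment> \<open>This level lies past \<open>t0\<close> and is odd, so its truncation is a
      lower bound.\<close>
    then have "a < ?L (2 * t0 + 1)" by simp
    then have "eventually (\<lambda>m. a < ?B (2 * t0 + 1) m) sequentially"
      using BL by (rule order_tendstoD(1)[rotated])
    then show "eventually (\<lambda>m. a < pmf (q m) j) sequentially"
      by eventually_elim (use lo[of "2 * t0 + 1"] in \<open>fastforce intro: less_le_trans\<close>)
  next
    fix a assume "?P < a"
    then have "eventually (\<lambda>t. ?L t < a) sequentially"
      using LP by (rule order_tendstoD(2)[rotated])
    then obtain t0 where "\<And>t. t \<ge> t0 \<Longrightarrow> ?L t < a" by (auto simp: eventually_sequentially)
    then have "?L (2 * t0) < a" by simp
    then have "eventually (\<lambda>m. ?B (2 * t0) m < a) sequentially"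
      using BL by (rule order_tendstoD(2)[rotated])
    then show "eventually (\<lambda>m. pmf (q m) j < a) sequentially"
      by eventually_elim (use up[of "2 * t0"] in \<open>fastforce intro: le_less_trans\<close>)
  qed
qed

section \<open>From point masses to weak convergence\<close>

lemma cdf_distr_real_of_nat_pmf:
  fixes q :: "nat pmf"
  shows "cdf (distr (measure_pmf q) borel real) x = (\<Sum>j\<in>{j. real j \<le> x}. pmf q j)"
proof -
  have "real j \<le> x \<longleftrightarrow> (if x < 0 then False else j \<le> nat \<lfloor>x\<rfloor>)" for j
    by (auto simp: le_nat_floor le_floor_iff nat_le_iff) linarith+
  then have "{j. real j \<le> x} \<subseteq> {..nat \<lfloor>x\<rfloor>}" by (auto split: if_splits)
  then have fin: "finite {j. real j \<le> x}" by (rule finite_subset) simp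
  have "cdf (distr (measure_pmf q) borel real) x = measure (measure_pmf q) {j. real j \<le> x}"
    unfolding cdf_def by (subst measure_distr) (auto simp: vimage_def)
  then show ?thesis using fin by (simp add: measure_measure_pmf_finite)
qed

text \<open>A value of the distribution function is a finite sum of point masses, so pointwise
  convergence suffices and no tightness argument is needed.\<close>

lemma weak_conv_m_real_of_nat_pmf:
  fixes q :: "nat \<Rightarrow> nat pmf" and q' :: "nat pmf"
  assumes "\<And>j. (\<lambda>m. pmf (q m) j) \<longlonglongrightarrow> pmf q' j"
  shows "weak_conv_m (\<lambda>m. distr (measure_pmf (q m)) borel real) (distr (measure_pmf q') borel real)"
  unfolding weak_conv_m_def weak_conv_def cdf_distr_real_of_nat_pmf
  by (intro allI impI tendsto_sum assms)

theorem weak_conv_m_poisson: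
  fixes q :: "nat \<Rightarrow> nat pmf"
  assumes "lam > 0" and "\<And>m. finite (set_pmf (q m))"
    and "\<And>r. (\<lambda>m. measure_pmf.expectation (q m) (\<lambda>x. real (x choose r))) \<longlonglongrightarrow> lam ^ r / fact r"
  shows "weak_conv_m (\<lambda>m. distr (measure_pmf (q m)) borel real)
           (distr (measure_pmf (poisson_pmf lam)) borel real)"
  by (rule weak_conv_m_real_of_nat_pmf) (use assms pmf_tendsto_poisson in simp)

section \<open>Walsh characters of a pattern graph\<close>

locale finite_simple_graph =
  fixes VF :: "'a set" and EF :: "'a set set"
  assumes graph: "simple_graph VF EF"
begin

lemma finite_VF [simp, intro]: "finite VF"
  using graph by (simp add: simple_graph_def)

lemma edge_cases:
  assumes "e \<in> EF"
  obtains x y where "x \<noteq> y" "x \<in> VF" "y \<in> VF" "e = {x, y}"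
  using graph assms by (auto simp: simple_graph_def)

lemma edge_subset: "e \<in> EF \<Longrightarrow> e \<subseteq> VF"
  by (auto elim: edge_cases)

lemma card_edge: "e \<in> EF \<Longrightarrow> card e = 2"
  by (auto elim: edge_cases)

lemma finite_EF [simp, intro]: "finite EF"
  by (rule finite_subset[of _ "Pow VF"]) (use edge_subset in auto)

text \<open>One index for each condition on a homomorphism: a singleton for the weight of a vertex,
  an edge for an inner product.\<close>

definition freq :: "'a set set" where
  "freq = (\<lambda>v. {v}) ` VF \<union> EF"

lemma finite_freq [simp, intro]: "finite freq"
  by (simp add: freq_def)

lemma freq_subset: "A \<in> freq \<Longrightarrow> A \<subseteq> VF"
  using edge_subset by (auto simp: freq_def)

lemma freq_nonempty: "A \<in> freq \<Longrightarrow> A \<noteq> {}"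
  by (auto simp: freq_def dest: card_edge)

lemma singleton_notin_EF: "{v} \<notin> EF"
  using card_edge by fastforce

lemma prod_freq: "(\<Prod>A\<in>freq. f A) = (\<Prod>v\<in>VF. f {v}) * (\<Prod>e\<in>EF. f e)"
proof -
  have "(\<Prod>A\<in>freq. f A) = (\<Prod>A\<in>(\<lambda>v. {v}) ` VF. f A) * (\<Prod>e\<in>EF. f e)"
    unfolding freq_def using singleton_notin_EF by (intro prod.union_disjoint) auto
  then show ?thesis by (simp add: prod.reindex)
qed

lemma sum_freq: "(\<Sum>A\<in>freq. f A) = (\<Sum>v\<in>VF. f {v}) + (\<Sum>e\<in>EF. f e)"
proof -
  have "(\<Sum>A\<in>freq. f A) = (\<Sum>A\<in>(\<lambda>v. {v}) ` VF. f A) + (\<Sum>e\<in>EF. f e)"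
    unfolding freq_def using singleton_notin_EF by (intro sum.union_disjoint) auto
  then show ?thesis by (simp add: sum.reindex)
qed

lemma card_freq: "card freq = card VF + card EF"
  using sum_freq[of "\<lambda>_. 1::nat"] by simp

definition cube :: "('a \<Rightarrow> nat) set" where
  "cube = (VF \<rightarrow>\<^sub>E {0, 1})"

lemma finite_cube [simp, intro]: "finite cube"
  by (auto simp: cube_def intro: finite_PiE)

lemma card_cube: "card cube = 2 ^ card VF"
  by (simp add: cube_def card_PiE numeral_2_eq_2)

definition chi :: "'a set \<Rightarrow> ('a \<Rightarrow> nat) \<Rightarrow> real" where
  "chi A u = (\<Prod>v\<in>A. 2 * real (u v) - 1)"

lemma chi_singleton: "chi {v} u = 2 * real (u v) - 1"
  by (simp add: chi_def)

lemma cube_vals: "u \<in> cube \<Longrightarrow> v \<in> VF \<Longrightarrow> u v = 0 \<or> u v = 1"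
  by (auto simp: cube_def PiE_iff)

lemma abs_chi: "u \<in> cube \<Longrightarrow> A \<subseteq> VF \<Longrightarrow> \<bar>chi A u\<bar> = 1"
  unfolding chi_def abs_prod by (rule prod.neutral) (use cube_vals[of u] in force)

text \<open>The sum factors over the coordinates, and each coordinate in \<open>A\<close>
  contributes \<open>- 1 + 1\<close>.\<close>

lemma sum_chi:
  assumes "A \<subseteq> VF" "A \<noteq> {}"
  shows "(\<Sum>u\<in>cube. chi A u) = 0"
proof -
  let ?g = "\<lambda>v y. if v \<in> A then 2 * real y - 1 else (1::real)"
  have "(\<Sum>u\<in>cube. chi A u) = (\<Sum>u\<in>VF \<rightarrow>\<^sub>E {0, 1}. \<Prod>v\<in>VF. ?g v (u v))"
    unfolding cube_def chi_def
  proof (rule sum.cong)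
    fix u
    have "(\<Prod>v\<in>A. 2 * real (u v) - 1) = (\<Prod>v\<in>A. ?g v (u v))"
      by (rule prod.cong) auto
    also have "\<dots> = (\<Prod>v\<in>VF. ?g v (u v))"
      by (rule prod.mono_neutral_left) (use assms in auto)
    finally show "(\<Prod>v\<in>A. 2 * real (u v) - 1) = (\<Prod>v\<in>VF. ?g v (u v))" .
  qed simp
  also have "\<dots> = (\<Prod>v\<in>VF. \<Sum>y\<in>{0, 1}. ?g v y)"
    by (rule prod_sum_PiE[symmetric]) auto
  also have "\<dots> = 0"
    using assms by (intro prod_zero) auto
  finally show ?thesis .
qed

text \<open>Signs square to 1, so the coordinates common to \<open>A\<close> and \<open>B\<close>
  cancel.\<close>

lemma chi_mult:
  assumes "u \<in> cube" "A \<subseteq> VF" "B \<subseteq> VF"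
  shows "chi A u * chi B u = chi ((A - B) \<union> (B - A)) u"
proof -
  have fin: "finite A" "finite B" using assms(2,3) by (auto intro: finite_subset)
  have "chi A u = chi (A - B) u * chi (A \<inter> B) u"
    unfolding chi_def using fin by (subst prod.union_disjoint[symmetric]) (auto intro: prod.cong)
  moreover have "chi B u = chi (B - A) u * chi (A \<inter> B) u"
    unfolding chi_def using fin by (subst prod.union_disjoint[symmetric]) (auto intro: prod.cong)
  moreover have "chi (A \<inter> B) u * chi (A \<inter> B) u = 1"
    using abs_chi[of u "A \<inter> B"] assms by (metis abs_mult_self_eq le_infI1 mult_1)
  moreover have "chi ((A - B) \<union> (B - A)) u = chi (A - B) u * chi (B - A) u"
    unfolding chi_def using fin by (intro prod.union_disjoint) auto
  ultimately show ?thesis by simp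
qed

text \<open>Equivalently, for a uniform point of the cube the vector of characters has identity
  covariance. This is why vertices and edges decouple in the limit.\<close>

lemma sum_chi_mult:
  assumes "A \<in> freq" "B \<in> freq"
  shows "(\<Sum>u\<in>cube. chi A u * chi B u) = (if A = B then 2 ^ card VF else 0)"
proof (cases "A = B")
  case True
  have "(\<Sum>u\<in>cube. chi A u * chi B u) = (\<Sum>u\<in>cube. 1)"
    using True abs_chi[OF _ freq_subset[OF assms(1)]] by (intro sum.cong) (metis abs_mult_self_eq mult_1)+
  then show ?thesis using True by (simp add: card_cube)
next
  case False
  have "(\<Sum>u\<in>cube. chi A u * chi B u) = (\<Sum>u\<in>cube. chi ((A - B) \<union> (B - A)) u)"
    by (intro sum.cong chi_mult freq_subset assms) auto
  also have "\<dots> = 0"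
    using False assms[THEN freq_subset] by (intro sum_chi) auto
  finally show ?thesis using False by simp
qed

section \<open>The characteristic function of the vector of characters\<close>

definition phase :: "('a set \<Rightarrow> real) \<Rightarrow> ('a \<Rightarrow> nat) \<Rightarrow> real" where
  "phase t u = (\<Sum>A\<in>freq. t A * chi A u)"

definition sqnorm :: "('a set \<Rightarrow> real) \<Rightarrow> real" where
  "sqnorm t = (\<Sum>A\<in>freq. (t A)\<^sup>2)"

lemma sum_phase: "(\<Sum>u\<in>cube. phase t u) = 0"
proof -
  have "(\<Sum>u\<in>cube. phase t u) = (\<Sum>A\<in>freq. t A * (\<Sum>u\<in>cube. chi A u))"
    unfolding phase_def by (subst sum.swap) (simp add: sum_distrib_left)
  then show ?thesis by (simp add: sum_chi freq_subset freq_nonempty)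
qed

text \<open>Parseval's identity: orthogonality kills the mixed terms of the square.\<close>

lemma sum_phase_sq: "(\<Sum>u\<in>cube. (phase t u)\<^sup>2) = 2 ^ card VF * sqnorm t"
proof -
  have "(phase t u)\<^sup>2 = (\<Sum>A\<in>freq. \<Sum>B\<in>freq. t A * t B * (chi A u * chi B u))" for u
    unfolding phase_def power2_eq_square sum_product by (simp add: algebra_simps)
  then have "(\<Sum>u\<in>cube. (phase t u)\<^sup>2) =
      (\<Sum>u\<in>cube. \<Sum>A\<in>freq. \<Sum>B\<in>freq. t A * t B * (chi A u * chi B u))"
    by simp
  also have "\<dots> = (\<Sum>A\<in>freq. \<Sum>u\<in>cube. \<Sum>B\<in>freq. t A * t B * (chi A u * chi B u))"
    by (rule sum.swap)
  also have "\<dots> = (\<Sum>A\<in>freq. \<Sum>B\<in>freq. t A * t B * (\<Sum>u\<in>cube. chi A u * chi B u))"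
    by (simp add: sum_distrib_left sum.swap[of _ cube])
  also have "\<dots> = (\<Sum>A\<in>freq. \<Sum>B\<in>freq. if A = B then 2 ^ card VF * (t A)\<^sup>2 else 0)"
    by (intro sum.cong refl) (simp add: sum_chi_mult power2_eq_square)
  finally show ?thesis
    by (simp add: sqnorm_def sum_distrib_left)
qed

definition Psi :: "('a set \<Rightarrow> real) \<Rightarrow> complex" where
  "Psi t = (\<Sum>u\<in>cube. iexp (phase t u)) / 2 ^ card VF"

lemma norm_Psi_le_1: "norm (Psi t) \<le> 1"
proof -
  have "norm (\<Sum>u\<in>cube. iexp (phase t u)) \<le> (\<Sum>u\<in>cube. 1)"
    by (rule sum_norm_le) simp
  then show ?thesis by (simp add: Psi_def norm_divide norm_power card_cube)
qed

text \<open>The squared modulus is the average of \<open>cos (phase t u - phase t w)\<close> over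
  all pairs. The defect from 1 is thus a sum of nonnegative terms, each of which it
  controls.\<close>

lemma one_minus_norm_Psi_sq:
  "1 - (norm (Psi t))\<^sup>2 = (\<Sum>u\<in>cube. \<Sum>w\<in>cube. 2 * (sin ((phase t u - phase t w) / 2))\<^sup>2) / 4 ^ card VF"
proof -
  have "complex_of_real ((norm (\<Sum>u\<in>cube. iexp (phase t u)))\<^sup>2) =
      (\<Sum>u\<in>cube. iexp (phase t u)) * cnj (\<Sum>u\<in>cube. iexp (phase t u))"
    by (rule complex_norm_square)
  also have "\<dots> = (\<Sum>u\<in>cube. \<Sum>w\<in>cube. iexp (phase t u - phase t w))"
    by (simp add: sum_product exp_cnj ring_distribs flip: exp_add)
  finally have "(norm (\<Sum>u\<in>cube. iexp (phase t u)))\<^sup>2 = Re (\<Sum>u\<in>cube. \<Sum>w\<in>cube. iexp (phase t u - phase t w))"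
    by (metis Re_complex_of_real)
  also have "\<dots> = (\<Sum>u\<in>cube. \<Sum>w\<in>cube. cos (phase t u - phase t w))"
    by (simp add: Re_exp del: of_real_diff)
  also have "\<dots> = (\<Sum>u\<in>cube. \<Sum>w\<in>cube. 1 - 2 * (sin ((phase t u - phase t w) / 2))\<^sup>2)"
    by (intro sum.cong refl) (metis cos_double_sin mult.commute nonzero_eq_divide_eq zero_neq_numeral)
  also have "\<dots> = 4 ^ card VF - (\<Sum>u\<in>cube. \<Sum>w\<in>cube. 2 * (sin ((phase t u - phase t w) / 2))\<^sup>2)"
    by (simp add: sum_subtractf card_cube flip: power_mult_distrib)
  finally have "(norm (Psi t))\<^sup>2 = (4 ^ card VF - (\<Sum>u\<in>cube. \<Sum>w\<in>cube. 2 * (sin ((phase t u - phase t w) / 2))\<^sup>2)) / (2 ^ card VF)\<^sup>2"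
    by (simp add: Psi_def norm_divide norm_power power_divide)
  also have "(2 ^ card VF)\<^sup>2 = (4 ^ card VF :: real)"
    by (simp add: power2_eq_square flip: power_mult_distrib)
  finally show ?thesis by (simp add: field_simps)
qed

lemma sin_phase_diff_sq_le:
  assumes "u \<in> cube" "w \<in> cube"
  shows "(sin ((phase t u - phase t w) / 2))\<^sup>2 \<le> 4 ^ card VF / 2 * (1 - (norm (Psi t))\<^sup>2)"
proof -
  have "2 * (sin ((phase t u - phase t w) / 2))\<^sup>2 \<le> (\<Sum>w\<in>cube. 2 * (sin ((phase t u - phase t w) / 2))\<^sup>2)"
    by (rule member_le_sum[where f = "\<lambda>w. 2 * (sin ((phase t u - phase t w) / 2))\<^sup>2"]) (use assms in auto)
  also have "\<dots> \<le> (\<Sum>u\<in>cube. \<Sum>w\<in>cube. 2 * (sin ((phase t u - phase t w) / 2))\<^sup>2)"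
    by (rule member_le_sum[where f = "\<lambda>u. \<Sum>w\<in>cube. 2 * (sin ((phase t u - phase t w) / 2))\<^sup>2"])
       (use assms in \<open>auto intro: sum_nonneg\<close>)
  finally show ?thesis by (simp add: one_minus_norm_Psi_sq)
qed

section \<open>Differences of the phase under coordinate flips\<close>

definition flip :: "'a \<Rightarrow> ('a \<Rightarrow> nat) \<Rightarrow> ('a \<Rightarrow> nat)" where
  "flip v u = u(v := 1 - u v)"

lemma flip_cube: "u \<in> cube \<Longrightarrow> v \<in> VF \<Longrightarrow> flip v u \<in> cube"
  by (auto simp: cube_def flip_def PiE_iff extensional_def)

lemma chi_flip:
  assumes "u \<in> cube" "v \<in> VF" "A \<subseteq> VF"
  shows "chi A (flip v u) = (if v \<in> A then - chi A u else chi A u)"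
proof (cases "v \<in> A")
  case True
  have fin: "finite A" using assms finite_subset by auto
  have "2 * real (flip v u v) - 1 = - (2 * real (u v) - 1)"
    using cube_vals[OF assms(1,2)] by (auto simp: flip_def)
  moreover have "(\<Prod>w\<in>A - {v}. 2 * real (flip v u w) - 1) = (\<Prod>w\<in>A - {v}. 2 * real (u w) - 1)"
    by (rule prod.cong) (auto simp: flip_def)
  ultimately show ?thesis
    using True fin by (simp only: chi_def prod.remove[of A v] if_True mult_minus_left)
next
  case False
  then have "chi A (flip v u) = chi A u"
    unfolding chi_def by (intro prod.cong) (auto simp: flip_def)
  then show ?thesis using False by simp
qed

text \<open>A flip at \<open>v\<close> negates exactly the characters whose index contains
  \<open>v\<close>; all others drop out of the difference.\<close>

lemma phase_flip_vertex:
  assumes "u \<in> cube" "v \<in> VF"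
  shows "phase t u - phase t (flip v u) = 2 * (t {v} * chi {v} u + (\<Sum>e | e \<in> EF \<and> v \<in> e. t e * chi e u))"
proof -
  have "phase t u - phase t (flip v u) = (\<Sum>A\<in>freq. if v \<in> A then 2 * (t A * chi A u) else 0)"
    unfolding phase_def sum_subtractf[symmetric]
    using assms by (intro sum.cong) (auto simp: chi_flip freq_subset)
  also have "\<dots> = 2 * (t {v} * chi {v} u) + (\<Sum>e\<in>EF. if v \<in> e then 2 * (t e * chi e u) else 0)"
    unfolding sum_freq using assms by (simp add: sum.delta)
  also have "(\<Sum>e\<in>EF. if v \<in> e then 2 * (t e * chi e u) else 0) =
      (\<Sum>e | e \<in> EF \<and> v \<in> e. 2 * (t e * chi e u))"
    by (simp add: sum.inter_filter)
  finally show ?thesis by (simp add: sum_distrib_left)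
qed

text \<open>In a second difference only indices containing both \<open>a\<close> and
  \<open>b\<close> survive, and \<open>{a, b}\<close> is the only such index.\<close>

lemma phase_flip_edge:
  assumes "u \<in> cube" "a \<noteq> b" "{a, b} \<in> EF"
  shows "(phase t u - phase t (flip a u)) - (phase t (flip b u) - phase t (flip a (flip b u))) =
    4 * (t {a, b} * chi {a, b} u)"
proof -
  have ab: "a \<in> VF" "b \<in> VF" using edge_subset[OF assms(3)] by auto
  have eq: "{e. e \<in> EF \<and> a \<in> e \<and> b \<in> e} = {{a, b}}"
    using assms by (auto elim: edge_cases)
  have "(phase t u - phase t (flip a u)) - (phase t (flip b u) - phase t (flip a (flip b u))) =
      2 * (\<Sum>e | e \<in> EF \<and> a \<in> e. t e * chi e u - t e * chi e (flip b u))"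
    using assms ab
    by (simp add: phase_flip_vertex flip_cube chi_flip sum_subtractf algebra_simps)
  also have "(\<Sum>e | e \<in> EF \<and> a \<in> e. t e * chi e u - t e * chi e (flip b u)) =
      (\<Sum>e | e \<in> EF \<and> a \<in> e. if b \<in> e then 2 * (t e * chi e u) else 0)"
    using assms(1) ab by (intro sum.cong) (auto simp: chi_flip edge_subset)
  also have "\<dots> = (\<Sum>e\<in>{e. e \<in> EF \<and> a \<in> e \<and> b \<in> e}. 2 * (t e * chi e u))"
    by (subst sum.inter_filter[symmetric]) (auto intro!: sum.cong)
  finally show ?thesis by (simp add: eq)
qed

end

section \<open>Decay of the characteristic function\<close>

text \<open>Jordan's inequality, from concavity of the sine, with \<open>pi / 2\<close> rounded up
  to \<open>2\<close>.\<close>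

lemma abs_le_2_abs_sin:
  fixes x :: real
  assumes "\<bar>x\<bar> \<le> pi / 2"
  shows "\<bar>x\<bar> \<le> 2 * \<bar>sin x\<bar>"
proof -
  have pos: "y \<le> 2 * sin y" if y: "0 \<le> y" "y \<le> pi / 2" for y :: real
  proof (cases "y = 0")
    case False
    have conc: "concave_on {0..pi/2} (\<lambda>x. sin x)"
      unfolding concave_on_def
      by (rule convex_on_realI[where f' = "\<lambda>x. - cos x"])
         (auto intro!: derivative_eq_intros cos_monotone_0_pi_le)
    define s where "s = y / (pi / 2)"
    have s: "0 \<le> s" "s \<le> 1" using y by (auto simp: s_def)
    have "sin ((1 - s) *\<^sub>R 0 + s *\<^sub>R (pi / 2)) \<ge> (1 - s) * sin 0 + s * sin (pi / 2)"
      using concave_onD[OF conc s, of 0 "pi/2"] by simp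
    then have "sin y \<ge> s" using y by (simp add: s_def)
    moreover have "s * (pi / 2) \<le> s * 2"
      using s(1) pi_less_4 by (intro mult_left_mono) auto
    moreover have "y = s * (pi / 2)"
      by (simp add: s_def)
    ultimately show ?thesis by linarith
  qed simp
  have "\<bar>x\<bar> \<le> 2 * sin \<bar>x\<bar>" using pos[of "\<bar>x\<bar>"] assms by simp
  then show ?thesis by (cases "x \<ge> 0") auto
qed

lemma abs_sin_add_le:
  fixes x y :: real
  shows "\<bar>sin (x + y)\<bar> \<le> \<bar>sin x\<bar> + \<bar>sin y\<bar>"
proof -
  have "\<bar>sin (x + y)\<bar> \<le> \<bar>sin x * cos y\<bar> + \<bar>cos x * sin y\<bar>"
    unfolding sin_add by (rule abs_triangle_ineq)
  also have "\<dots> \<le> \<bar>sin x\<bar> + \<bar>sin y\<bar>"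
    unfolding abs_mult by (intro add_mono mult_left_le mult_left_le_one_le) auto
  finally show ?thesis .
qed

lemma abs_sin_diff_le:
  fixes x y :: real
  shows "\<bar>sin (x - y)\<bar> \<le> \<bar>sin x\<bar> + \<bar>sin y\<bar>"
  using abs_sin_add_le[of x "- y"] by simp

lemma abs_sin_sum_le:
  fixes f :: "'b \<Rightarrow> real"
  shows "\<bar>sin (\<Sum>i\<in>I. f i)\<bar> \<le> (\<Sum>i\<in>I. \<bar>sin (f i)\<bar>)"
proof (induction I rule: infinite_finite_induct)
  case (insert i I)
  then show ?case using abs_sin_add_le[of "f i" "sum f I"] by simp
qed auto

context finite_simple_graph
begin

text \<open>Half a first difference of the phase isolates \<open>t {v}\<close>, half a second
  difference isolates \<open>2 * t e\<close>. Both must lie in the range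
  \<open>[-pi/2, pi/2]\<close>, on which the sine controls its argument.\<close>

definition halfwidth :: "'a set \<Rightarrow> real" where
  "halfwidth A = (if card A = 1 then pi / 2 else pi / 4)"

lemma halfwidth_vertex [simp]: "halfwidth {v} = pi / 2"
  by (simp add: halfwidth_def)

lemma halfwidth_edge: "e \<in> EF \<Longrightarrow> halfwidth e = pi / 4"
  by (simp add: halfwidth_def card_edge)

lemma halfwidth_pos: "halfwidth A > 0"
  by (simp add: halfwidth_def)

text \<open>All characters equal 1 here, so flips starting from this point read off frequencies
  without signs.\<close>

definition top_corner :: "'a \<Rightarrow> nat" where
  "top_corner = (\<lambda>v\<in>VF. 1)"

lemma top_corner_cube: "top_corner \<in> cube"
  by (auto simp: top_corner_def cube_def)

lemma chi_top_corner: "A \<subseteq> VF \<Longrightarrow> chi A top_corner = 1"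
  unfolding chi_def by (rule prod.neutral) (auto simp: top_corner_def)

text \<open>Collects the losses of \<open>norm_Psi_le\<close>: the number of frequencies (with 1
  added so that an empty graph is covered), the square of the factor \<open>C\<close> between a
  frequency and the sine bound, and the number of pairs of cube points.\<close>

definition decay :: real where
  "decay = 1 / ((real (card freq) + 1) * (2 * (1 + 2 * real (card EF)))\<^sup>2 * 4 ^ card VF)"

lemma decay_pos: "decay > 0"
  unfolding decay_def by (intro divide_pos_pos mult_pos_pos) auto

text \<open>Flipping one or two coordinates isolates each frequency up to an integer factor: within the
  box, a small value of \<open>1 - |\<Psi>|\<^sup>2\<close> forces every phase difference close to a multiple
  of \<open>2\<pi>\<close>, hence every frequency close to \<open>0\<close>.\<close>

lemma norm_Psi_le:
  assumes box: "\<And>A. A \<in> freq \<Longrightarrow> \<bar>t A\<bar> \<le> halfwidth A"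
  shows "norm (Psi t) \<le> exp (- decay * sqnorm t)"
proof -
  define \<delta> where "\<delta> = 1 - (norm (Psi t))\<^sup>2"
  define \<epsilon> where "\<epsilon> = sqrt (4 ^ card VF / 2 * \<delta>)"
  have \<delta>0: "\<delta> \<ge> 0"
    using norm_Psi_le_1[of t] by (simp add: \<delta>_def power_le_one)
  then have \<epsilon>0: "\<epsilon> \<ge> 0" by (simp add: \<epsilon>_def)
  have diff: "\<bar>sin ((phase t u - phase t w) / 2)\<bar> \<le> \<epsilon>" if "u \<in> cube" "w \<in> cube" for u w
    unfolding \<epsilon>_def \<delta>_def real_sqrt_abs[symmetric] using sin_phase_diff_sq_le[OF that, of t]
    by (rule real_sqrt_le_mono)
  let ?u = top_corner
  let ?l = "real (card EF)"
  define C where "C = 2 * (1 + 2 * ?l)"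
  have C2: "C \<ge> 2" by (simp add: C_def)
  have edge: "\<bar>t e\<bar> \<le> 2 * \<epsilon>" if e: "e \<in> EF" for e
  proof -
    obtain a b where ab: "a \<noteq> b" "a \<in> VF" "b \<in> VF" "e = {a, b}"
      using e by (rule edge_cases)
    \<comment> \<open>At \<open>top_corner\<close> the second difference is \<open>4 * t e\<close>;
      splitting its half into two half phase differences allows \<open>diff\<close> to bound each
      sine.\<close>
    have "2 * t e = (phase t ?u - phase t (flip a ?u)) / 2 -
        (phase t (flip b ?u) - phase t (flip a (flip b ?u))) / 2"
      using phase_flip_edge[OF top_corner_cube ab(1), of t] e chi_top_corner[OF edge_subset[OF e]]
      unfolding ab(4) by simp argo
    then have "\<bar>sin (2 * t e)\<bar> \<le> \<bar>sin ((phase t ?u - phase t (flip a ?u)) / 2)\<bar> +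
        \<bar>sin ((phase t (flip b ?u) - phase t (flip a (flip b ?u))) / 2)\<bar>"
      using abs_sin_diff_le by metis
    also have "\<dots> \<le> \<epsilon> + \<epsilon>"
      by (intro add_mono diff flip_cube top_corner_cube ab)
    finally have "\<bar>sin (2 * t e)\<bar> \<le> \<epsilon> + \<epsilon>" .
    moreover have "\<bar>2 * t e\<bar> \<le> 2 * \<bar>sin (2 * t e)\<bar>"
      using box[of e] e by (intro abs_le_2_abs_sin) (auto simp: freq_def halfwidth_edge)
    ultimately show ?thesis by simp
  qed
  have vertex: "\<bar>t {v}\<bar> \<le> C * \<epsilon>" if v: "v \<in> VF" for v
  proof -
    \<comment> \<open>A single flip also picks up the incident edges, whose frequencies are already
      known to be small. Comparing sines rather than arguments makes multiples of pi
      harmless.\<close>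
    have "(phase t ?u - phase t (flip v ?u)) / 2 = t {v} + (\<Sum>e | e \<in> EF \<and> v \<in> e. t e)"
      using v by (simp add: phase_flip_vertex top_corner_cube chi_top_corner edge_subset)
    then have "t {v} = (phase t ?u - phase t (flip v ?u)) / 2 - (\<Sum>e | e \<in> EF \<and> v \<in> e. t e)"
      by linarith
    then have "\<bar>sin (t {v})\<bar> \<le> \<bar>sin ((phase t ?u - phase t (flip v ?u)) / 2)\<bar> +
        \<bar>sin (\<Sum>e | e \<in> EF \<and> v \<in> e. t e)\<bar>"
      using abs_sin_diff_le by metis
    also have "\<dots> \<le> \<epsilon> + \<bar>sin (\<Sum>e | e \<in> EF \<and> v \<in> e. t e)\<bar>"
      by (intro add_right_mono diff flip_cube top_corner_cube v)
    also have "\<bar>sin (\<Sum>e | e \<in> EF \<and> v \<in> e. t e)\<bar> \<le> (\<Sum>e | e \<in> EF \<and> v \<in> e. \<bar>sin (t e)\<bar>)"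
      by (rule abs_sin_sum_le)
    also have "\<dots> \<le> (\<Sum>e | e \<in> EF \<and> v \<in> e. 2 * \<epsilon>)"
      by (intro sum_mono order.trans[OF abs_sin_x_le_abs_x] edge) auto
    also have "\<dots> \<le> (\<Sum>e\<in>EF. 2 * \<epsilon>)"
      using \<epsilon>0 by (intro sum_mono2) auto
    finally have "\<bar>sin (t {v})\<bar> \<le> (1 + 2 * ?l) * \<epsilon>" by (simp add: algebra_simps)
    moreover have "\<bar>t {v}\<bar> \<le> 2 * \<bar>sin (t {v})\<bar>"
      using box[of "{v}"] v by (intro abs_le_2_abs_sin) (auto simp: freq_def)
    ultimately show ?thesis by (simp add: C_def algebra_simps)
  qed
  have bound: "\<bar>t A\<bar> \<le> C * \<epsilon>" if A: "A \<in> freq" for A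
  proof (cases "A \<in> EF")
    case True
    then show ?thesis using edge mult_right_mono[OF C2 \<epsilon>0] by fastforce
  next
    case False
    then show ?thesis using A vertex by (auto simp: freq_def)
  qed
  have "sqnorm t \<le> (\<Sum>A\<in>freq. (C * \<epsilon>)\<^sup>2)"
    unfolding sqnorm_def
  proof (rule sum_mono)
    fix A assume "A \<in> freq"
    then have "\<bar>t A\<bar>\<^sup>2 \<le> (C * \<epsilon>)\<^sup>2" using bound by (intro power_mono) auto
    then show "(t A)\<^sup>2 \<le> (C * \<epsilon>)\<^sup>2" by simp
  qed
  also have "\<dots> = real (card freq) * C\<^sup>2 * (4 ^ card VF / 2 * \<delta>)"
    using \<delta>0 by (simp add: \<epsilon>_def power_mult_distrib real_sqrt_pow2)
  also have "\<dots> \<le> (real (card freq) + 1) * C\<^sup>2 * (4 ^ card VF / 2 * \<delta>)"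
    using \<delta>0 by (intro mult_right_mono) auto
  also have "\<dots> = \<delta> / (2 * decay)"
    by (simp add: decay_def C_def)
  finally have "2 * decay * sqnorm t \<le> \<delta>"
    using decay_pos by (simp add: field_simps)
  then have "(norm (Psi t))\<^sup>2 \<le> 1 + (- 2 * decay * sqnorm t)"
    by (simp add: \<delta>_def)
  also have "\<dots> \<le> exp (- 2 * decay * sqnorm t)"
    by (rule exp_ge_add_one_self)
  also have "\<dots> = (exp (- decay * sqnorm t))\<^sup>2"
    by (simp add: power2_eq_square flip: exp_add)
  finally show ?thesis
    by (rule power2_le_imp_le) simp
qed

text \<open>Expand each exponential to second order: the linear terms cancel by
  \<open>sum_phase\<close>, and the quadratic ones are given by \<open>sum_phase_sq\<close>. The
  factor \<open>1 / 2 ^ card VF\<close> in the remainder is discarded.\<close>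

lemma norm_Psi_taylor:
  "norm (Psi t - (1 - complex_of_real (sqnorm t / 2))) \<le> (\<Sum>u\<in>cube. \<bar>phase t u\<bar> ^ 3)"
proof -
  have "(\<Sum>u\<in>cube. \<Sum>k\<le>2. (\<i> * complex_of_real (phase t u)) ^ k / fact k) =
      (\<Sum>u\<in>cube. 1 + \<i> * complex_of_real (phase t u) - complex_of_real ((phase t u)\<^sup>2) / 2)"
    by (intro sum.cong refl) (simp add: numeral_2_eq_2 power2_eq_square algebra_simps)
  also have "\<dots> = 2 ^ card VF + \<i> * complex_of_real (\<Sum>u\<in>cube. phase t u) -
      complex_of_real (\<Sum>u\<in>cube. (phase t u)\<^sup>2) / 2"
    by (simp add: sum.distrib sum_subtractf card_cube sum_distrib_left sum_divide_distrib)
  also have "\<dots> = 2 ^ card VF * (1 - complex_of_real (sqnorm t / 2))"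
    by (simp only: sum_phase sum_phase_sq) (simp add: algebra_simps)
  finally have eq: "1 - complex_of_real (sqnorm t / 2) =
      (\<Sum>u\<in>cube. \<Sum>k\<le>2. (\<i> * complex_of_real (phase t u)) ^ k / fact k) / 2 ^ card VF"
    by simp
  have "Psi t - (1 - complex_of_real (sqnorm t / 2)) =
      (\<Sum>u\<in>cube. iexp (phase t u) - (\<Sum>k\<le>2. (\<i> * complex_of_real (phase t u)) ^ k / fact k)) / 2 ^ card VF"
    unfolding Psi_def eq by (simp add: sum_subtractf diff_divide_distrib)
  also have "norm \<dots> \<le> norm (\<Sum>u\<in>cube. iexp (phase t u) - (\<Sum>k\<le>2. (\<i> * complex_of_real (phase t u)) ^ k / fact k)) / 1"
    by (simp add: norm_divide norm_power divide_le_eq mult_le_cancel_left1 self_le_power)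
  also have "\<dots> \<le> (\<Sum>u\<in>cube. \<bar>phase t u\<bar> ^ 3)"
  proof -
    have "norm (iexp (phase t u) - (\<Sum>k\<le>2. (\<i> * complex_of_real (phase t u)) ^ k / fact k)) \<le> \<bar>phase t u\<bar> ^ 3" for u
    proof -
      have "norm (iexp (phase t u) - (\<Sum>k\<le>2. (\<i> * complex_of_real (phase t u)) ^ k / fact k)) \<le> \<bar>phase t u\<bar> ^ 3 / fact 3"
        using iexp_approx1[of "phase t u" 2] by (simp add: eval_nat_numeral)
      also have "\<dots> \<le> \<bar>phase t u\<bar> ^ 3 / 1"
        by (intro divide_left_mono) auto
      finally show ?thesis by simp
    qed
    then show ?thesis by (auto intro: sum_norm_le)
  qed
  finally show ?thesis .
qed

lemma phase_scale: "phase (\<lambda>A. t A / s) u = phase t u / s"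
  by (simp add: phase_def sum_divide_distrib)

lemma sqnorm_scale: "sqnorm (\<lambda>A. t A / s) = sqnorm t / s\<^sup>2"
  by (simp add: sqnorm_def sum_divide_distrib power_divide)

lemma sqnorm_nonneg: "sqnorm t \<ge> 0"
  by (simp add: sqnorm_def sum_nonneg)

text \<open>For numbers in the unit disc the \<open>n\<close>-th powers differ by at most
  \<open>n\<close> times the difference of the bases. Here the bases differ by a multiple of
  \<open>n powr (- 3 / 2)\<close>, so comparison with \<open>(1 - sqnorm t / (2 n)) ^ n\<close>
  suffices.\<close>

lemma Psi_power_tendsto:
  "(\<lambda>n. Psi (\<lambda>A. t A / sqrt (real n)) ^ n) \<longlonglongrightarrow> complex_of_real (exp (- sqnorm t / 2))"
proof -
  define C where "C = (\<Sum>u\<in>cube. \<bar>phase t u\<bar> ^ 3)"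
  define w where "w n = 1 + (- sqnorm t / 2) / real n" for n :: nat
  have "(\<lambda>n. norm (Psi (\<lambda>A. t A / sqrt (real n)) ^ n - complex_of_real (w n) ^ n)) \<longlonglongrightarrow> 0"
  proof (rule tendsto_sandwich[where f = "\<lambda>_. 0" and h = "\<lambda>n. C / sqrt (real n)"])
    \<comment> \<open>Beyond \<open>n0\<close> the comparison base \<open>w n\<close> lies in the
      unit interval.\<close>
    obtain n0 :: nat where n0: "real n0 \<ge> sqnorm t" using real_arch_simple by blast
    show "eventually (\<lambda>n. norm (Psi (\<lambda>A. t A / sqrt (real n)) ^ n - complex_of_real (w n) ^ n) \<le> C / sqrt (real n)) sequentially"
      using eventually_ge_at_top[of n0] eventually_gt_at_top[of 0]
    proof eventually_elim
      case (elim n)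
      then have n: "real n > 0" "sqnorm t \<le> real n" using n0 by auto
      have "\<bar>w n\<bar> \<le> 1"
        unfolding w_def using n sqnorm_nonneg[of t] by (intro abs_leI) (auto simp: field_simps)
      then have "norm (Psi (\<lambda>A. t A / sqrt (real n)) ^ n - complex_of_real (w n) ^ n) \<le>
          real n * norm (Psi (\<lambda>A. t A / sqrt (real n)) - complex_of_real (w n))"
        by (intro norm_power_diff norm_Psi_le_1) simp
      also have "\<dots> \<le> real n * (\<Sum>u\<in>cube. \<bar>phase t u / sqrt (real n)\<bar> ^ 3)"
      proof -
        have "complex_of_real (w n) = 1 - complex_of_real (sqnorm (\<lambda>A. t A / sqrt (real n)) / 2)"
          using n by (simp add: w_def sqnorm_scale)
        then show ?thesis
          using norm_Psi_taylor[of "\<lambda>A. t A / sqrt (real n)"] unfolding phase_scale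
          by (intro mult_left_mono) auto
      qed
      also have "(\<Sum>u\<in>cube. \<bar>phase t u / sqrt (real n)\<bar> ^ 3) = C / (sqrt (real n)) ^ 3"
        by (simp add: C_def sum_divide_distrib power_divide)
      also have "real n * (C / (sqrt (real n)) ^ 3) = C / sqrt (real n)"
        using n by (simp add: power3_eq_cube field_simps)
      finally show ?case .
    qed
    show "(\<lambda>n. C / sqrt (real n)) \<longlonglongrightarrow> 0"
      by (intro tendsto_divide_0[OF tendsto_const] filterlim_at_top_imp_at_infinity
            filterlim_compose[OF sqrt_at_top] filterlim_real_sequentially)
  qed auto
  then have "(\<lambda>n. Psi (\<lambda>A. t A / sqrt (real n)) ^ n - complex_of_real (w n) ^ n) \<longlonglongrightarrow> 0"
    by (rule tendsto_norm_zero_cancel)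
  moreover have "(\<lambda>n. complex_of_real (w n) ^ n) \<longlonglongrightarrow> complex_of_real (exp (- sqnorm t / 2))"
    unfolding w_def of_real_power[symmetric]
    by (intro tendsto_of_real tendsto_exp_limit_sequentially)
  ultimately show ?thesis
    by (rule Lim_transform2[rotated, where f = "\<lambda>n. complex_of_real (w n) ^ n"] Lim_transform[rotated])
qed

end

section \<open>Local limit theorem for homomorphism counts\<close>

lemma integral_iexp_Icc:
  fixes S a :: real
  assumes "a \<ge> 0"
  shows "(\<integral>t. indicator {-a..a} t *\<^sub>R iexp (t * S) \<partial>lborel) =
    complex_of_real (if S = 0 then 2 * a else 2 * sin (a * S) / S)"
proof (cases "S = 0")
  case True
  have "(\<integral>t. indicator {-a..a} t *\<^sub>R iexp (t * S) \<partial>lborel) = (\<integral>t. indicator {-a..a} t *\<^sub>R (1::complex) \<partial>lborel)"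
    using True by simp
  also have "\<dots> = measure lborel {-a..a} *\<^sub>R 1"
    by (subst integral_scaleR_left) (auto intro!: integrable_real_indicator simp: emeasure_lborel_Icc_eq)
  finally show ?thesis using True assms by (simp add: scaleR_conv_of_real)
next
  case False
  have "(\<integral>t. indicator {-a..a} t *\<^sub>R iexp (t * S) \<partial>lborel) =
      iexp (a * S) / (\<i> * S) - iexp (- a * S) / (\<i> * S)"
  proof (rule integral_FTC_Icc)
    show "- a \<le> a" using assms by simp
    fix x :: real
    have "((\<lambda>x. exp (\<i> * (x * of_real S)) / (\<i> * S)) has_field_derivative iexp (x * S)) (at (of_real x))"
      using False by (auto intro!: derivative_eq_intros) (simp add: mult.commute mult.left_commute)
    from has_vector_derivative_real_field[OF this]
    show "((\<lambda>x. iexp (x * S) / (\<i> * S)) has_vector_derivative iexp (x * S)) (at x within {- a..a})"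
      by simp
  qed (intro continuous_intros)
  also have "\<dots> = (cis (a * S) - cis (- (a * S))) / (\<i> * S)"
    by (simp add: cis_conv_exp diff_divide_distrib)
  also have "\<dots> = complex_of_real (2 * sin (a * S) / S)"
    using False by (simp add: complex_eq_iff Re_divide_of_real field_simps cis.ctr Complex_eq)
  finally show ?thesis using False by simp
qed

lemma integrable_iexp_Icc:
  "integrable lborel (\<lambda>t. indicator {-a..a} t *\<^sub>R iexp (t * S))"
  by (rule borel_integrable_compact) (auto intro!: continuous_intros)

lemma integrable_exp_neg_sq:
  assumes "c > 0"
  shows "integrable lborel (\<lambda>x::real. exp (- c * x\<^sup>2))"
proof -
  define \<sigma> where "\<sigma> = sqrt (1 / (2 * c))"
  have \<sigma>: "\<sigma> > 0" "\<sigma>\<^sup>2 = 1 / (2 * c)" using assms by (auto simp: \<sigma>_def)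
  have "integrable lborel (\<lambda>x. sqrt (2 * pi * \<sigma>\<^sup>2) * normal_density 0 \<sigma> x)"
    using \<sigma> by (intro integrable_mult_right integrable_normal_density) auto
  moreover have "sqrt (2 * pi * \<sigma>\<^sup>2) * normal_density 0 \<sigma> x = exp (- c * x\<^sup>2)" for x
    using \<sigma> assms by (simp add: normal_density_def mult.commute)
  ultimately show ?thesis by simp
qed

lemma integral_exp_neg_sq_half:
  "(\<integral>x. exp (- (x::real)\<^sup>2 / 2) \<partial>lborel) = sqrt (2 * pi)"
proof -
  have "(\<integral>x. sqrt (2 * pi) * std_normal_density x \<partial>lborel) = sqrt (2 * pi) * 1"
    by (subst integral_mult_right_zero) (simp add: integral_normal_density)
  moreover have "sqrt (2 * pi) * std_normal_density x = exp (- x\<^sup>2 / 2)" for x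
    by (simp add: std_normal_density_def)
  ultimately show ?thesis by simp
qed

context finite_simple_graph
begin

definition homs :: "nat \<Rightarrow> ('a \<Rightarrow> nat \<Rightarrow> nat) set" where
  "homs n = {x \<in> VF \<rightarrow>\<^sub>E dg_V n. \<forall>a b. {a, b} \<in> EF \<longrightarrow> dg_inner n (x a) (x b) = n div 4}"

definition wsum :: "nat \<Rightarrow> 'a set \<Rightarrow> (nat \<Rightarrow> 'a \<Rightarrow> nat) \<Rightarrow> real" where
  "wsum n A w = (\<Sum>i<n. chi A (w i))"

abbreviation words :: "nat \<Rightarrow> (nat \<Rightarrow> 'a \<Rightarrow> nat) set" where
  "words n \<equiv> {..<n} \<rightarrow>\<^sub>E cube"

lemma finite_words [simp, intro]: "finite (words n)"
  by (intro finite_PiE) auto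

lemma wsum_vertex: "wsum n {v} w = 2 * (\<Sum>i<n. real (w i v)) - real n"
  by (simp add: wsum_def chi_singleton sum_subtractf sum_distrib_left)

lemma wsum_edge:
  assumes "a \<noteq> b"
  shows "wsum n {a, b} w = 4 * (\<Sum>i<n. real (w i a) * real (w i b)) - 2 * (\<Sum>i<n. real (w i a))
    - 2 * (\<Sum>i<n. real (w i b)) + real n"
proof -
  have "wsum n {a, b} w = (\<Sum>i<n. 4 * (real (w i a) * real (w i b)) - 2 * real (w i a) - 2 * real (w i b) + 1)"
    unfolding wsum_def chi_def using assms by (intro sum.cong) (auto simp: algebra_simps)
  then show ?thesis
    by (simp add: sum_subtractf sum.distrib sum_distrib_left)
qed

text \<open>Transpose the matrix of bits: its rows are vertices of \<open>G\<close>, its columns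
  points of the cube. Edge sums encode inner products only in combination with the vertex sums, and
  \<open>4 dvd n\<close> makes the two quotients exact.\<close>

lemma bij_betw_homs_words:
  assumes "4 dvd n"
  shows "bij_betw (\<lambda>x. \<lambda>i\<in>{..<n}. \<lambda>v\<in>VF. x v i) (homs n) {w \<in> words n. \<forall>A\<in>freq. wsum n A w = 0}"
\<comment> \<open>The inverse pads with 0 because members of \<open>dg_V n\<close> vanish from
  position \<open>n\<close> on.\<close>
proof (rule bij_betw_byWitness[where f' = "\<lambda>w. \<lambda>v\<in>VF. \<lambda>i. if i < n then w i v else 0"])
  have half: "n div 2 = 2 * (n div 4)" "real n = 4 * real (n div 4)"
    using assms by auto
  have half': "real n / 2 = real (n div 2)" "real n / 4 = real (n div 4)"
    using half by simp_all
  have sum_half: "(\<Sum>i<n. real (f i)) = real n / 2 \<longleftrightarrow> (\<Sum>i<n. f i) = n div 2" for f :: "nat \<Rightarrow> nat"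
    unfolding half' of_nat_sum[symmetric] of_nat_eq_iff ..
  have inner_quarter: "(\<Sum>i<n. real (f i) * real (g i)) = real n / 4 \<longleftrightarrow> (\<Sum>i<n. f i * g i) = n div 4"
    for f g :: "nat \<Rightarrow> nat"
    unfolding half' of_nat_mult[symmetric] of_nat_sum[symmetric] of_nat_eq_iff ..
  show "\<forall>x\<in>homs n. (\<lambda>v\<in>VF. \<lambda>i. if i < n then (\<lambda>i\<in>{..<n}. \<lambda>v\<in>VF. x v i) i v else 0) = x"
  proof
    fix x assume x: "x \<in> homs n"
    then have ext: "x \<in> extensional VF" and dg: "\<And>v. v \<in> VF \<Longrightarrow> x v \<in> dg_V n"
      by (auto simp: homs_def PiE_iff)
    show "(\<lambda>v\<in>VF. \<lambda>i. if i < n then (\<lambda>i\<in>{..<n}. \<lambda>v\<in>VF. x v i) i v else 0) = x"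
    proof (rule extensionalityI[of _ VF])
      fix v assume v: "v \<in> VF"
      then show "(\<lambda>v\<in>VF. \<lambda>i. if i < n then (\<lambda>i\<in>{..<n}. \<lambda>v\<in>VF. x v i) i v else 0) v = x v"
        using dg[OF v] by (auto simp: dg_V_def fun_eq_iff)
    qed (use ext in auto)
  qed
  show "\<forall>w\<in>{w \<in> words n. \<forall>A\<in>freq. wsum n A w = 0}.
      (\<lambda>i\<in>{..<n}. \<lambda>v\<in>VF. (\<lambda>v\<in>VF. \<lambda>i. if i < n then w i v else 0) v i) = w"
  proof
    fix w assume w: "w \<in> {w \<in> words n. \<forall>A\<in>freq. wsum n A w = 0}"
    show "(\<lambda>i\<in>{..<n}. \<lambda>v\<in>VF. (\<lambda>v\<in>VF. \<lambda>i. if i < n then w i v else 0) v i) = w"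
    proof (rule extensionalityI[of _ "{..<n}"])
      fix i assume i: "i \<in> {..<n}"
      then have "w i \<in> extensional VF" using w by (auto simp: cube_def PiE_iff)
      then show "(\<lambda>i\<in>{..<n}. \<lambda>v\<in>VF. (\<lambda>v\<in>VF. \<lambda>i. if i < n then w i v else 0) v i) i = w i"
        using i by (auto simp: fun_eq_iff extensional_def)
    qed (use w in \<open>auto simp: PiE_iff\<close>)
  qed
  show "(\<lambda>x. \<lambda>i\<in>{..<n}. \<lambda>v\<in>VF. x v i) ` homs n \<subseteq> {w \<in> words n. \<forall>A\<in>freq. wsum n A w = 0}"
  proof (rule image_subsetI)
    fix x assume x: "x \<in> homs n"
    then have dg: "\<And>v. v \<in> VF \<Longrightarrow> x v \<in> dg_V n"
      and inn: "\<And>a b. {a, b} \<in> EF \<Longrightarrow> dg_inner n (x a) (x b) = n div 4"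
      by (auto simp: homs_def PiE_iff)
    let ?w = "\<lambda>i\<in>{..<n}. \<lambda>v\<in>VF. x v i"
    have cube: "?w i \<in> cube" if "i \<in> {..<n}" for i
      using that dg by (auto simp: cube_def dg_V_def)
    have vert: "(\<Sum>i<n. real (x v i)) = real n / 2" if "v \<in> VF" for v
      unfolding sum_half using dg[OF that] by (simp add: dg_V_def)
    have "wsum n A ?w = 0" if A: "A \<in> freq" for A
    proof -
      consider v where "v \<in> VF" "A = {v}" | "A \<in> EF" using A by (auto simp: freq_def)
      then show "wsum n A ?w = 0"
      proof cases
        case 1
        then show ?thesis using vert[of v] by (simp add: wsum_vertex)
      next
        case 2
        then obtain a b where ab: "a \<noteq> b" "a \<in> VF" "b \<in> VF" "A = {a, b}" by (rule edge_cases)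
        have "(\<Sum>i<n. real (x a i) * real (x b i)) = real n / 4"
          unfolding inner_quarter using inn[of a b] 2 ab by (simp add: dg_inner_def)
        then show ?thesis using vert[of a] vert[of b] ab by (simp add: wsum_edge)
      qed
    qed
    with cube show "?w \<in> {w \<in> words n. \<forall>A\<in>freq. wsum n A w = 0}"
      by (auto simp: PiE_iff)
  qed
  show "(\<lambda>w. \<lambda>v\<in>VF. \<lambda>i. if i < n then w i v else 0) ` {w \<in> words n. \<forall>A\<in>freq. wsum n A w = 0} \<subseteq> homs n"
  proof (rule image_subsetI)
    fix w assume "w \<in> {w \<in> words n. \<forall>A\<in>freq. wsum n A w = 0}"
    then have w: "w \<in> words n" and z: "\<forall>A\<in>freq. wsum n A w = 0" by auto
    let ?x = "\<lambda>v\<in>VF. \<lambda>i. if i < n then w i v else 0"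
    have sum1: "(\<Sum>i<n. real (w i v)) = real n / 2" if "v \<in> VF" for v
      using z that wsum_vertex[of n v w] by (auto simp: freq_def)
    have mem: "?x v \<in> dg_V n" if v: "v \<in> VF" for v
    proof -
      have "w i v \<in> {0, 1}" if "i < n" for i
        using w v that cube_vals[of "w i" v] by auto
      then show ?thesis
        using sum1[OF v] v unfolding sum_half by (auto simp: dg_V_def)
    qed
    moreover have "dg_inner n (?x a) (?x b) = n div 4" if e: "{a, b} \<in> EF" for a b
    proof -
      have ab: "a \<in> VF" "b \<in> VF" "a \<noteq> b"
        using e edge_subset[OF e] card_edge[OF e] by auto
      have "wsum n {a, b} w = 0" using z e by (auto simp: freq_def)
      then have "(\<Sum>i<n. real (w i a) * real (w i b)) = real n / 4"
        using ab by (simp add: wsum_edge sum1)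
      then show ?thesis unfolding inner_quarter using ab by (simp add: dg_inner_def)
    qed
    ultimately show "?x \<in> homs n" by (auto simp: homs_def)
  qed
qed

section \<open>Fourier inversion over the box\<close>

text \<open>The indicator of the box dilated by \<open>s\<close>, written as a product so that
  integrals split over the frequencies.\<close>

definition freq_box :: "real \<Rightarrow> ('a set \<Rightarrow> real) \<Rightarrow> real" where
  "freq_box s t = (\<Prod>A\<in>freq. indicator {- (halfwidth A * s)..halfwidth A * s} (t A))"

text \<open>Once the vertex sums vanish, every edge sum is a multiple of \<open>4\<close>, so integrating over the
  halved range \<open>[-\<pi>/4, \<pi>/4]\<close> already detects whether it is zero.\<close>

lemma prod_integral_words:
  assumes "4 dvd n" "s > 0" "w \<in> words n"
  shows "(\<Prod>A\<in>freq. \<integral>t. indicator {- (halfwidth A * s)..halfwidth A * s} t *\<^sub>R iexp (t * (wsum n A w / s)) \<partial>lborel) =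
    complex_of_real (if \<forall>A\<in>freq. wsum n A w = 0 then \<Prod>A\<in>freq. 2 * (halfwidth A * s) else 0)"
proof -
  obtain m where m: "n = 4 * m" using assms by auto
  let ?J = "\<lambda>A. \<integral>t. indicator {- (halfwidth A * s)..halfwidth A * s} t *\<^sub>R iexp (t * (wsum n A w / s)) \<partial>lborel"
  have J: "?J A = complex_of_real (if wsum n A w = 0 then 2 * (halfwidth A * s)
      else 2 * sin (halfwidth A * wsum n A w) / (wsum n A w / s))" for A
    using assms(2) halfwidth_pos[of A] by (subst integral_iexp_Icc) auto
  show ?thesis
  proof (cases "\<forall>A\<in>freq. wsum n A w = 0")
    case True
    then have "(\<Prod>A\<in>freq. ?J A) = (\<Prod>A\<in>freq. complex_of_real (2 * (halfwidth A * s)))"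
      by (intro prod.cong refl, subst J) simp
    then show ?thesis using True by simp
  next
    case False
    have "\<exists>A\<in>freq. ?J A = 0"
    proof (cases "\<forall>v\<in>VF. wsum n {v} w = 0")
      case vert: True
      then obtain A where A: "A \<in> EF" "wsum n A w \<noteq> 0" using False by (auto simp: freq_def)
      then obtain a b where ab: "a \<noteq> b" "a \<in> VF" "b \<in> VF" "A = {a, b}" by (auto elim: edge_cases)
      have "wsum n A w = 4 * (\<Sum>i<n. real (w i a) * real (w i b)) - real n"
        using vert ab by (auto simp: wsum_edge wsum_vertex)
      also have "\<dots> = 4 * of_int (int (\<Sum>i<n. w i a * w i b) - int m)"
        by (simp add: m)
      finally have "halfwidth A * wsum n A w = of_int (int (\<Sum>i<n. w i a * w i b) - int m) * pi"
        using A by (simp add: halfwidth_edge)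
      then have "sin (halfwidth A * wsum n A w) = 0"
        unfolding sin_times_pi_eq_0[symmetric] by (simp only: sin_times_pi_eq_0) auto
      then have "?J A = 0" by (subst J) (simp add: A)
      then show ?thesis using A by (intro bexI[of _ A]) (simp_all add: freq_def)
    next
      case nv: False
      then obtain v where v: "v \<in> VF" "wsum n {v} w \<noteq> 0" by auto
      \<comment> \<open>As \<open>n\<close> is even, a vertex sum is an even integer, and
        \<open>pi / 2\<close> times it is a multiple of pi. A single nonzero vertex sum therefore
        annihilates the product.\<close>
      have "wsum n {v} w = 2 * of_int (int (\<Sum>i<n. w i v) - 2 * int m)"
        by (simp add: wsum_vertex m)
      then have "halfwidth {v} * wsum n {v} w = of_int (int (\<Sum>i<n. w i v) - 2 * int m) * pi"
        by simp
      then have "sin (halfwidth {v} * wsum n {v} w) = 0"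
        by (simp only: sin_times_pi_eq_0) auto
      then have "?J {v} = 0" by (subst J) (simp add: v)
      then show ?thesis using v by (intro bexI[of _ "{v}"]) (simp_all add: freq_def)
    qed
    then have "(\<Prod>A\<in>freq. ?J A) = 0" by (intro prod_zero) auto
    then show ?thesis by (simp only: False if_False of_real_0)
  qed
qed

text \<open>Multiplying out the \<open>n\<close>-th power gives one term per word. Collecting
  exponents by frequency instead of by coordinate turns that term into a product of one-dimensional
  functions.\<close>

lemma box_integrand_expand:
  "freq_box s t *\<^sub>R (\<Sum>u\<in>cube. iexp (phase (\<lambda>A. t A / s) u)) ^ n =
   (\<Sum>w\<in>words n. \<Prod>A\<in>freq. indicator {- (halfwidth A * s)..halfwidth A * s} (t A) *\<^sub>R iexp (t A * (wsum n A w / s)))"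
proof -
  have "(\<Sum>u\<in>cube. iexp (phase (\<lambda>A. t A / s) u)) ^ n = (\<Prod>i<n. \<Sum>u\<in>cube. iexp (phase (\<lambda>A. t A / s) u))"
    by simp
  also have "\<dots> = (\<Sum>w\<in>words n. \<Prod>i<n. iexp (phase (\<lambda>A. t A / s) (w i)))"
    by (rule prod_sum_PiE) auto
  also have "\<dots> = (\<Sum>w\<in>words n. \<Prod>A\<in>freq. iexp (t A * (wsum n A w / s)))"
  proof (rule sum.cong[OF refl])
    fix w
    have "(\<Prod>i<n. iexp (phase (\<lambda>A. t A / s) (w i))) = exp (\<Sum>i<n. \<i> * complex_of_real (phase (\<lambda>A. t A / s) (w i)))"
      by (simp add: exp_sum)
    also have "(\<Sum>i<n. \<i> * complex_of_real (phase (\<lambda>A. t A / s) (w i))) = \<i> * complex_of_real (\<Sum>i<n. phase (\<lambda>A. t A / s) (w i))"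
      by (simp add: sum_distrib_left)
    also have "(\<Sum>i<n. phase (\<lambda>A. t A / s) (w i)) = (\<Sum>A\<in>freq. t A * (wsum n A w / s))"
      unfolding phase_def wsum_def by (subst sum.swap) (simp add: sum_distrib_left sum_divide_distrib)
    also have "exp (\<i> * complex_of_real \<dots>) = (\<Prod>A\<in>freq. iexp (t A * (wsum n A w / s)))"
      unfolding of_real_sum sum_distrib_left by (rule exp_sum) simp
    finally show "(\<Prod>i<n. iexp (phase (\<lambda>A. t A / s) (w i))) = (\<Prod>A\<in>freq. iexp (t A * (wsum n A w / s)))" .
  qed
  finally show ?thesis
    by (simp add: freq_box_def sum_distrib_left scaleR_conv_of_real prod.distrib)
qed

text \<open>Each word integrates either to the volume of the box or to 0, according to whether all
  its sums vanish.\<close>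

lemma homs_fourier:
  assumes "4 dvd n" "s > 0"
  shows "(\<integral>t. freq_box s t *\<^sub>R (\<Sum>u\<in>cube. iexp (phase (\<lambda>A. t A / s) u)) ^ n \<partial>(Pi\<^sub>M freq (\<lambda>_. lborel))) =
    complex_of_real (real (card (homs n)) * (\<Prod>A\<in>freq. 2 * (halfwidth A * s)))"
proof -
  interpret product_sigma_finite "\<lambda>_::'a set. lborel :: real measure" by standard
  let ?h = "\<lambda>w A x. indicator {- (halfwidth A * s)..halfwidth A * s} x *\<^sub>R iexp (x * (wsum n A w / s))"
  let ?P = "Pi\<^sub>M freq (\<lambda>_. lborel :: real measure)"
  let ?Z = "{w \<in> words n. \<forall>A\<in>freq. wsum n A w = 0}"
  have "(\<integral>t. freq_box s t *\<^sub>R (\<Sum>u\<in>cube. iexp (phase (\<lambda>A. t A / s) u)) ^ n \<partial>?P) =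
      (\<Sum>w\<in>words n. \<integral>t. (\<Prod>A\<in>freq. ?h w A (t A)) \<partial>?P)"
    unfolding box_integrand_expand
    by (rule Bochner_Integration.integral_sum) (intro product_integrable_prod integrable_iexp_Icc finite_freq)
  also have "\<dots> = (\<Sum>w\<in>words n. \<Prod>A\<in>freq. \<integral>x. ?h w A x \<partial>lborel)"
    by (intro sum.cong refl product_integral_prod integrable_iexp_Icc finite_freq)
  also have "\<dots> = (\<Sum>w\<in>words n. complex_of_real (if \<forall>A\<in>freq. wsum n A w = 0 then \<Prod>A\<in>freq. 2 * (halfwidth A * s) else 0))"
    by (intro sum.cong refl prod_integral_words assms)
  also have "\<dots> = complex_of_real (\<Sum>w\<in>?Z. \<Prod>A\<in>freq. 2 * (halfwidth A * s))"
    by (subst sum.inter_filter) auto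
  also have "(\<Sum>w\<in>?Z. \<Prod>A\<in>freq. 2 * (halfwidth A * s)) = real (card ?Z) * (\<Prod>A\<in>freq. 2 * (halfwidth A * s))"
    by simp
  also have "card ?Z = card (homs n)"
    using bij_betw_same_card[OF bij_betw_homs_words[OF assms(1)]] by simp
  finally show ?thesis .
qed

section \<open>Passage to the limit under the integral\<close>

abbreviation freq_measure :: "('a set \<Rightarrow> real) measure" where
  "freq_measure \<equiv> Pi\<^sub>M freq (\<lambda>_. lborel)"

lemma measurable_coord [measurable]: "A \<in> freq \<Longrightarrow> (\<lambda>t. t A) \<in> borel_measurable freq_measure"
  by (rule measurable_component_singleton[where M = "\<lambda>_. lborel", simplified measurable_lborel1]) simp

lemma measurable_freq_box [measurable]: "freq_box s \<in> borel_measurable freq_measure"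
  unfolding freq_box_def by measurable

lemma measurable_Psi [measurable]: "(\<lambda>t. Psi (\<lambda>A. t A / s)) \<in> borel_measurable freq_measure"
  unfolding Psi_def phase_def by measurable

lemma measurable_sqnorm [measurable]: "sqnorm \<in> borel_measurable freq_measure"
  unfolding sqnorm_def by measurable

lemma freq_box_eq: "freq_box s t = (if \<forall>A\<in>freq. \<bar>t A\<bar> \<le> halfwidth A * s then 1 else 0)"
proof (cases "\<forall>A\<in>freq. \<bar>t A\<bar> \<le> halfwidth A * s")
  case True
  then show ?thesis
    unfolding freq_box_def by (auto intro!: prod.neutral simp: indicator_def abs_le_iff)
next
  case False
  then obtain A where A: "A \<in> freq" "\<not> \<bar>t A\<bar> \<le> halfwidth A * s" by blast
  then have "indicator {- (halfwidth A * s)..halfwidth A * s} (t A) = (0::real)"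
    by (auto simp: indicator_def abs_le_iff)
  then have "freq_box s t = 0"
    unfolding freq_box_def using A(1) by (intro prod_zero) auto
  then show ?thesis using False by simp
qed

text \<open>Dividing \<open>t\<close> by \<open>sqrt n\<close> moves it into the unscaled box and
  divides \<open>sqnorm t\<close> by \<open>n\<close>; the \<open>n\<close>-th power restores it.
  The bound is thus free of \<open>n\<close>, as dominated convergence requires.\<close>

lemma norm_box_Psi_power_le:
  "norm (freq_box (sqrt (real n)) t *\<^sub>R Psi (\<lambda>A. t A / sqrt (real n)) ^ n) \<le> exp (- decay * sqnorm t)"
proof (cases "\<forall>A\<in>freq. \<bar>t A\<bar> \<le> halfwidth A * sqrt (real n)")
  case True
  show ?thesis
  proof (cases "n = 0")
    case True
    \<comment> \<open>For \<open>n = 0\<close> the box shrinks to the origin, where both sides equal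
      1.\<close>
    then have "t A = 0" if "A \<in> freq" for A
      using that \<open>\<forall>A\<in>freq. \<bar>t A\<bar> \<le> halfwidth A * sqrt (real n)\<close> by auto
    then have "sqnorm t = 0" by (simp add: sqnorm_def)
    then show ?thesis using True by (simp add: freq_box_eq)
  next
    case n: False
    have "norm (Psi (\<lambda>A. t A / sqrt (real n))) \<le> exp (- decay * sqnorm (\<lambda>A. t A / sqrt (real n)))"
      using True n by (intro norm_Psi_le) (auto simp: abs_divide field_simps)
    then have "norm (Psi (\<lambda>A. t A / sqrt (real n))) ^ n \<le> exp (- decay * sqnorm (\<lambda>A. t A / sqrt (real n))) ^ n"
      by (intro power_mono) auto
    also have "\<dots> = exp (- decay * sqnorm t)"
      using n by (simp add: sqnorm_scale flip: exp_of_nat_mult)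
    finally show ?thesis using True by (simp add: freq_box_eq norm_power)
  qed
qed (auto simp: freq_box_eq)

text \<open>The boxes grow, so a fixed \<open>t\<close> is eventually inside and the cutoff
  disappears.\<close>

lemma box_Psi_power_tendsto:
  "(\<lambda>n. freq_box (sqrt (real n)) t *\<^sub>R Psi (\<lambda>A. t A / sqrt (real n)) ^ n) \<longlonglongrightarrow>
     complex_of_real (exp (- sqnorm t / 2))"
proof -
  have "eventually (\<lambda>n. \<forall>A\<in>freq. \<bar>t A\<bar> / halfwidth A \<le> sqrt (real n)) sequentially"
    by (intro eventually_ball_finite finite_freq ballI
          filterlim_compose[OF sqrt_at_top filterlim_real_sequentially, unfolded filterlim_at_top, rule_format])
  then have "eventually (\<lambda>n. Psi (\<lambda>A. t A / sqrt (real n)) ^ n =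
      freq_box (sqrt (real n)) t *\<^sub>R Psi (\<lambda>A. t A / sqrt (real n)) ^ n) sequentially"
    by eventually_elim (auto simp: freq_box_eq pos_divide_le_eq halfwidth_pos mult.commute)
  then show ?thesis
    by (rule Lim_transform_eventually[OF Psi_power_tendsto])
qed

lemma integrable_exp_sqnorm:
  assumes "c > 0"
  shows "integrable freq_measure (\<lambda>t. exp (- c * sqnorm t))"
proof -
  interpret product_sigma_finite "\<lambda>_::'a set. lborel :: real measure" by standard
  have "integrable freq_measure (\<lambda>t. \<Prod>A\<in>freq. exp (- c * (t A)\<^sup>2))"
    by (intro product_integrable_prod integrable_exp_neg_sq assms finite_freq)
  then show ?thesis by (simp add: sqnorm_def sum_distrib_left exp_sum sum_negf[symmetric])
qed

lemma integral_exp_sqnorm: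
  "(\<integral>t. exp (- sqnorm t / 2) \<partial>freq_measure) = sqrt (2 * pi) ^ card freq"
proof -
  interpret product_sigma_finite "\<lambda>_::'a set. lborel :: real measure" by standard
  have "(\<integral>t. exp (- sqnorm t / 2) \<partial>freq_measure) = (\<integral>t. (\<Prod>A\<in>freq. exp (- (t A)\<^sup>2 / 2)) \<partial>freq_measure)"
    by (simp add: sqnorm_def sum_divide_distrib exp_sum sum_negf[symmetric])
  also have "\<dots> = (\<Prod>A\<in>freq. \<integral>x. exp (- x\<^sup>2 / 2) \<partial>lborel)"
    using integrable_exp_neg_sq[of "1/2"] by (intro product_integral_prod finite_freq) simp
  finally show ?thesis by (simp only: integral_exp_neg_sq_half prod_constant)
qed

lemma integral_box_Psi_tendsto:
  "(\<lambda>n. \<integral>t. freq_box (sqrt (real n)) t *\<^sub>R Psi (\<lambda>A. t A / sqrt (real n)) ^ n \<partial>freq_measure) \<longlonglongrightarrow>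
     complex_of_real (sqrt (2 * pi) ^ card freq)"
proof -
  have "(\<lambda>n. \<integral>t. freq_box (sqrt (real n)) t *\<^sub>R Psi (\<lambda>A. t A / sqrt (real n)) ^ n \<partial>freq_measure) \<longlonglongrightarrow>
     (\<integral>t. complex_of_real (exp (- sqnorm t / 2)) \<partial>freq_measure)"
    by (rule integral_dominated_convergence[where w = "\<lambda>t. exp (- decay * sqnorm t)"])
       (use decay_pos integrable_exp_sqnorm box_Psi_power_tendsto norm_box_Psi_power_le in auto)
  then show ?thesis by (simp only: integral_complex_of_real integral_exp_sqnorm)
qed

text \<open>Local limit theorem: the number of homomorphisms over \<open>2 ^ (card VF * n)\<close>
  is the probability that all sums of a uniform word vanish, and multiplied by the volume of the box
  it tends to the Gaussian integral.\<close>

theorem card_homs_tendsto: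
  "(\<lambda>m. real (card (homs (4 * m))) * (\<Prod>A\<in>freq. 2 * (halfwidth A * sqrt (real (4 * m)))) / 2 ^ (card VF * (4 * m)))
     \<longlonglongrightarrow> sqrt (2 * pi) ^ card freq"
proof -
  let ?I = "\<lambda>n. \<integral>t. freq_box (sqrt (real n)) t *\<^sub>R Psi (\<lambda>A. t A / sqrt (real n)) ^ n \<partial>freq_measure"
  let ?X = "\<lambda>n. real (card (homs n)) * (\<Prod>A\<in>freq. 2 * (halfwidth A * sqrt (real n))) / 2 ^ (card VF * n)"
  have eq: "?I n = complex_of_real (?X n)" if "4 dvd n" "n > 0" for n
  proof -
    have "freq_box (sqrt (real n)) t *\<^sub>R Psi (\<lambda>A. t A / sqrt (real n)) ^ n =
        freq_box (sqrt (real n)) t *\<^sub>R (\<Sum>u\<in>cube. iexp (phase (\<lambda>A. t A / sqrt (real n)) u)) ^ n / 2 ^ (card VF * n)" for t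
      by (simp add: Psi_def power_divide power_mult scaleR_conv_of_real)
    then have "?I n = (\<integral>t. freq_box (sqrt (real n)) t *\<^sub>R (\<Sum>u\<in>cube. iexp (phase (\<lambda>A. t A / sqrt (real n)) u)) ^ n \<partial>freq_measure) / 2 ^ (card VF * n)"
      by simp
    then show ?thesis
      using homs_fourier[OF that(1), of "sqrt (real n)"] that(2) by simp
  qed
  have "filterlim (\<lambda>m. 4 * m) sequentially sequentially"
    by (rule filterlim_subseq) (auto simp: strict_mono_def)
  with integral_box_Psi_tendsto have "(\<lambda>m. ?I (4 * m)) \<longlonglongrightarrow> complex_of_real (sqrt (2 * pi) ^ card freq)"
    by (rule filterlim_compose)
  moreover have "eventually (\<lambda>m. ?I (4 * m) = complex_of_real (?X (4 * m))) sequentially"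
    using eventually_gt_at_top[of 0] by eventually_elim (rule eq, auto)
  ultimately have "(\<lambda>m. complex_of_real (?X (4 * m))) \<longlonglongrightarrow> complex_of_real (sqrt (2 * pi) ^ card freq)"
    by (rule Lim_transform_eventually)
  then show ?thesis by (simp only: tendsto_of_real_iff)
qed

end

section \<open>Copies of a strictly balanced graph\<close>

definition embeddings :: "'a set \<Rightarrow> 'a set set \<Rightarrow> 'b set \<Rightarrow> 'b set set \<Rightarrow> ('a \<Rightarrow> 'b) set" where
  "embeddings VF EF V E = {\<phi> \<in> VF \<rightarrow>\<^sub>E V. inj_on \<phi> VF \<and> (\<forall>e\<in>EF. \<phi> ` e \<in> E)}"

context finite_simple_graph
begin

lemma copiesE:
  assumes "c \<in> copies VF EF V E"
  obtains \<phi> where "bij_betw \<phi> VF (fst c)" "snd c = (`) \<phi> ` EF" "fst c \<subseteq> V" "snd c \<subseteq> E"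
  using assms unfolding copies_def by (cases c) auto

lemma inj_on_image_edges: "inj_on \<phi> VF \<Longrightarrow> inj_on ((`) \<phi>) EF"
  by (rule inj_on_subset[OF inj_on_image_Pow]) (use edge_subset in auto)

lemma card_fst_copy: "c \<in> copies VF EF V E \<Longrightarrow> card (fst c) = card VF"
  by (auto elim!: copiesE dest: bij_betw_same_card)

lemma finite_fst_copy: "c \<in> copies VF EF V E \<Longrightarrow> finite (fst c)"
  by (auto elim!: copiesE dest: bij_betw_finite)

lemma card_snd_copy: "c \<in> copies VF EF V E \<Longrightarrow> card (snd c) = card EF"
  by (auto elim!: copiesE dest!: bij_betw_imp_inj_on intro!: card_image inj_on_image_edges)

lemma finite_snd_copy: "c \<in> copies VF EF V E \<Longrightarrow> finite (snd c)"
  by (auto elim!: copiesE)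

lemma copy_edge_subset:
  assumes "c \<in> copies VF EF V E" "e \<in> snd c"
  shows "e \<subseteq> fst c" "e \<noteq> {}"
proof -
  obtain \<phi> where \<phi>: "bij_betw \<phi> VF (fst c)" "snd c = (`) \<phi> ` EF"
    using assms(1) by (rule copiesE)
  then obtain f where f: "f \<in> EF" "e = \<phi> ` f" using assms(2) by auto
  show "e \<subseteq> fst c" using edge_subset[OF f(1)] f(2) \<phi>(1) by (auto simp: bij_betw_def)
  show "e \<noteq> {}" using card_edge[OF f(1)] f(2) by auto
qed

lemma copies_subset: "copies VF EF V E \<subseteq> Pow V \<times> Pow E"
  by (auto simp: copies_def)

lemma finite_copies: "finite V \<Longrightarrow> finite E \<Longrightarrow> finite (copies VF EF V E)"
  by (rule finite_subset[OF copies_subset]) auto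

text \<open>A subgraph of the copy pulls back along the bijection to a subgraph of \<open>F\<close>
  with the same numbers of vertices and edges.\<close>

lemma strictly_balanced_copy:
  assumes sb: "strictly_balanced VF EF" and c: "c \<in> copies VF EF V E"
  shows "strictly_balanced (fst c) (snd c)"
  unfolding strictly_balanced_def
proof (intro allI impI, elim conjE)
  obtain \<phi> where \<phi>: "bij_betw \<phi> VF (fst c)" "snd c = (`) \<phi> ` EF"
    using c by (rule copiesE)
  have inj: "inj_on \<phi> VF" and img: "\<phi> ` VF = fst c" using \<phi>(1) by (auto simp: bij_betw_def)
  fix VH EH
  assume sub: "subgraph VH EH (fst c) (snd c)" and ne: "(VH, EH) \<noteq> (fst c, snd c)" and nonempty: "VH \<noteq> {}"
  define VH' where "VH' = {v \<in> VF. \<phi> v \<in> VH}"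
  define EH' where "EH' = {e \<in> EF. \<phi> ` e \<in> EH}"
  have VH: "\<phi> ` VH' = VH" using sub img by (auto simp: subgraph_def VH'_def)
  have EH: "(`) \<phi> ` EH' = EH" using sub \<phi>(2) by (auto simp: subgraph_def EH'_def)
  have "card VH' = card VH"
    unfolding VH[symmetric] by (rule card_image[symmetric], rule inj_on_subset[OF inj]) (auto simp: VH'_def)
  moreover have "card EH' = card EH"
    unfolding EH[symmetric]
    by (rule card_image[symmetric], rule inj_on_subset[OF inj_on_image_edges[OF inj]]) (auto simp: EH'_def)
  moreover have "subgraph VH' EH' VF EF"
  proof -
    have "e \<subseteq> VH'" if "e \<in> EH'" for e
    proof -
      have "\<phi> ` e \<subseteq> VH" "e \<subseteq> VF"
        using that sub edge_subset[of e] by (auto simp: EH'_def subgraph_def)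
      then show ?thesis by (auto simp: VH'_def)
    qed
    then show ?thesis by (auto simp: subgraph_def VH'_def EH'_def)
  qed
  moreover have "(VH', EH') \<noteq> (VF, EF)"
    using ne VH EH img \<phi>(2) by auto
  moreover have "VH' \<noteq> {}" using nonempty VH by auto
  ultimately have "real (card EH) / real (card VH) < real (card EF) / real (card VF)"
    using sb unfolding strictly_balanced_def by metis
  then show "real (card EH) / real (card VH) < real (card (snd c)) / real (card (fst c))"
    using c by (simp add: card_fst_copy card_snd_copy)
qed

section \<open>Density excess of families of copies\<close>

text \<open>The intersection of a copy with a graph on \<open>Z\<close> with edge set
  \<open>B\<close> is a subgraph of the copy. The density inequality is cross-multiplied to remain
  in the natural numbers.\<close>

lemma copy_overlap_less:
  assumes sb: "strictly_balanced VF EF" and c: "c \<in> copies VF EF V E"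
    and B: "\<And>e. e \<in> B \<Longrightarrow> e \<subseteq> Z"
    and meet: "fst c \<inter> Z \<noteq> {}" and ne: "(fst c \<inter> Z, snd c \<inter> B) \<noteq> c"
  shows "card VF * card (snd c \<inter> B) < card EF * card (fst c \<inter> Z)"
proof -
  have "subgraph (fst c \<inter> Z) (snd c \<inter> B) (fst c) (snd c)"
    using B copy_edge_subset[OF c] by (auto simp: subgraph_def)
  then have "real (card (snd c \<inter> B)) / real (card (fst c \<inter> Z)) < real (card EF) / real (card VF)"
    using strictly_balanced_copy[OF sb c] meet ne c
    by (auto simp: strictly_balanced_def card_fst_copy card_snd_copy)
  moreover have "card (fst c \<inter> Z) > 0" "card VF > 0"
    using meet finite_fst_copy[OF c] card_fst_copy[OF c] by (auto simp: card_gt_0_iff)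
  ultimately have "real (card VF * card (snd c \<inter> B)) < real (card EF * card (fst c \<inter> Z))"
    by (simp add: field_simps)
  then show ?thesis by (simp only: of_nat_less_iff)
qed

lemma copy_overlap_le:
  assumes sb: "strictly_balanced VF EF" and c: "c \<in> copies VF EF V E"
    and B: "\<And>e. e \<in> B \<Longrightarrow> e \<subseteq> Z"
  shows "card VF * card (snd c \<inter> B) \<le> card EF * card (fst c \<inter> Z)"
proof (cases "fst c \<inter> Z = {}")
  case True
  then have "snd c \<inter> B = {}" using B copy_edge_subset[OF c] by blast
  then show ?thesis by simp
next
  case meet: False
  show ?thesis
  proof (cases "(fst c \<inter> Z, snd c \<inter> B) = c")
    case True
    then have "fst c \<inter> Z = fst c" "snd c \<inter> B = snd c" by (metis fst_conv, metis snd_conv)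
    then show ?thesis using c by (simp add: card_fst_copy card_snd_copy)
  next
    case False
    show ?thesis by (rule less_imp_le, rule copy_overlap_less[OF sb c _ meet False]) (rule B)
  qed
qed

text \<open>Call \<open>k e - l v\<close> the excess of a union. A new copy alone has excess
  \<open>k l - l k = 0\<close>, so adding it changes the excess by \<open>l v - k e\<close> of the
  overlap, which is nonnegative. The additive form avoids truncated subtraction.\<close>

lemma union_insert_excess:
  assumes sb: "strictly_balanced VF EF" and c: "c \<in> copies VF EF V E"
    and S: "finite S" "S \<subseteq> copies VF EF V E"
  shows "card VF * card (\<Union>(snd ` S)) + card EF * card (\<Union>(fst ` insert c S)) \<le>
    card VF * card (\<Union>(snd ` insert c S)) + card EF * card (\<Union>(fst ` S))"
proof -
  let ?Z = "\<Union>(fst ` S)" and ?B = "\<Union>(snd ` S)"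
  have finZ: "finite ?Z" and finB: "finite ?B"
    using S by (auto intro!: finite_UN_I dest: finite_fst_copy finite_snd_copy)
  have sub: "e \<subseteq> ?Z" if e: "e \<in> ?B" for e
  proof -
    obtain d where "d \<in> S" "e \<in> snd d" using e by blast
    moreover have "e \<subseteq> fst d"
      using calculation S(2) by (intro copy_edge_subset(1)[of d V E]) auto
    ultimately show ?thesis by auto
  qed
  have v: "card (fst c \<union> ?Z) + card (fst c \<inter> ?Z) = card VF + card ?Z"
    using card_Un_Int[OF finite_fst_copy[OF c] finZ] card_fst_copy[OF c] by simp
  have e: "card (snd c \<union> ?B) + card (snd c \<inter> ?B) = card EF + card ?B"
    using card_Un_Int[OF finite_snd_copy[OF c] finB] card_snd_copy[OF c] by simp
  have v': "card EF * card (fst c \<union> ?Z) + card EF * card (fst c \<inter> ?Z) = card EF * card VF + card EF * card ?Z"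
    unfolding add_mult_distrib2[symmetric] v ..
  have e': "card VF * card (snd c \<union> ?B) + card VF * card (snd c \<inter> ?B) = card EF * card VF + card VF * card ?B"
    unfolding add_mult_distrib2[symmetric] e by (simp add: algebra_simps)
  have "card VF * card (snd c \<inter> ?B) \<le> card EF * card (fst c \<inter> ?Z)"
    by (rule copy_overlap_le[OF sb c]) (rule sub)
  then show ?thesis using v' e' by simp
qed

lemma union_excess_mono:
  assumes sb: "strictly_balanced VF EF"
    and S: "finite S" "S \<subseteq> copies VF EF V E" and T: "finite T" "T \<subseteq> copies VF EF V E"
    and less: "card EF * card (\<Union>(fst ` S)) < card VF * card (\<Union>(snd ` S))"
  shows "card EF * card (\<Union>(fst ` (T \<union> S))) < card VF * card (\<Union>(snd ` (T \<union> S)))"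
  using T
proof (induction T rule: finite_induct)
  case empty
  then show ?case using less by simp
next
  case (insert c T)
  then show ?case
    using union_insert_excess[OF sb, of c V E "T \<union> S"] S by simp
qed

text \<open>Start with two copies that meet; adding further copies never lowers the density excess.\<close>

lemma overlapping_copies_excess:
  assumes sb: "strictly_balanced VF EF"
    and S: "finite S" "S \<subseteq> copies VF EF V E"
    and cd: "c \<in> S" "d \<in> S" "c \<noteq> d" "fst c \<inter> fst d \<noteq> {}"
  shows "card EF * card (\<Union>(fst ` S)) < card VF * card (\<Union>(snd ` S))"
proof -
  have c: "c \<in> copies VF EF V E" and d: "d \<in> copies VF EF V E" using S cd by auto
  \<comment> \<open>Otherwise \<open>c\<close> is contained in \<open>d\<close>, and equal sizes
    force \<open>c = d\<close>.\<close>
  have ne: "(fst c \<inter> fst d, snd c \<inter> snd d) \<noteq> c"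
  proof
    assume eq: "(fst c \<inter> fst d, snd c \<inter> snd d) = c"
    then have "fst c \<subseteq> fst d" "snd c \<subseteq> snd d" by (metis fst_conv inf.cobounded2, metis snd_conv inf.cobounded2)
    then have "fst c = fst d" "snd c = snd d"
      using card_subset_eq[OF finite_fst_copy[OF d]] card_subset_eq[OF finite_snd_copy[OF d]]
        card_fst_copy[OF c] card_fst_copy[OF d] card_snd_copy[OF c] card_snd_copy[OF d] by auto
    then show False using cd(3) by (simp add: prod_eq_iff)
  qed
  have less: "card VF * card (snd c \<inter> snd d) < card EF * card (fst c \<inter> fst d)"
    using copy_overlap_less[OF sb c copy_edge_subset(1)[OF d] cd(4) ne] .
  have v: "card (fst c \<union> fst d) + card (fst c \<inter> fst d) = card VF + card VF"
    using card_Un_Int[OF finite_fst_copy[OF c] finite_fst_copy[OF d]] card_fst_copy c d by metis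
  have e: "card (snd c \<union> snd d) + card (snd c \<inter> snd d) = card EF + card EF"
    using card_Un_Int[OF finite_snd_copy[OF c] finite_snd_copy[OF d]] card_snd_copy c d by metis
  have v': "card EF * card (fst c \<union> fst d) + card EF * card (fst c \<inter> fst d) = 2 * card EF * card VF"
    unfolding add_mult_distrib2[symmetric] v by simp
  have e': "card VF * card (snd c \<union> snd d) + card VF * card (snd c \<inter> snd d) = 2 * card EF * card VF"
    unfolding add_mult_distrib2[symmetric] e by simp
  have "card EF * card (fst c \<union> fst d) < card VF * card (snd c \<union> snd d)"
    using v' e' less by linarith
  then have "card EF * card (\<Union>(fst ` {c, d})) < card VF * card (\<Union>(snd ` {c, d}))" by simp
  from union_excess_mono[OF sb _ _ S this] c d have
    "card EF * card (\<Union>(fst ` (S \<union> {c, d}))) < card VF * card (\<Union>(snd ` (S \<union> {c, d})))" by blast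
  moreover have "S \<union> {c, d} = S" using cd by auto
  ultimately show ?thesis by (simp only:)
qed

section \<open>Copies as classes of embeddings\<close>

text \<open>Two embeddings with the same image graph differ by precomposition with a unique
  automorphism of \<open>F\<close>.\<close>

lemma card_embeddings_fibre:
  assumes \<phi>: "\<phi> \<in> embeddings VF EF V E"
  shows "card {\<psi> \<in> embeddings VF EF V E. \<psi> ` VF = \<phi> ` VF \<and> (`) \<psi> ` EF = (`) \<phi> ` EF} = card (automorphisms VF EF)"
proof -
  let ?fib = "{\<psi> \<in> embeddings VF EF V E. \<psi> ` VF = \<phi> ` VF \<and> (`) \<psi> ` EF = (`) \<phi> ` EF}"
  let ?g = "inv_into VF \<phi>"
  have inj: "inj_on \<phi> VF" using \<phi> by (simp add: embeddings_def)
  have gf: "?g (\<phi> v) = v" if "v \<in> VF" for v using inj that by simp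
  have fg: "\<phi> (?g y) = y" if "y \<in> \<phi> ` VF" for y using that by (rule f_inv_into_f)
  have gin: "?g y \<in> VF" if "y \<in> \<phi> ` VF" for y using that by (rule inv_into_into)
  have edge_iff: "f \<in> EF \<longleftrightarrow> \<eta> ` f \<in> (`) \<eta> ` EF" if "inj_on \<eta> VF" "f \<subseteq> VF" for f and \<eta> :: "'a \<Rightarrow> 'b"
  proof
    assume "\<eta> ` f \<in> (`) \<eta> ` EF"
    then obtain e where "e \<in> EF" "\<eta> ` f = \<eta> ` e" by auto
    then show "f \<in> EF" using inj_on_image_eq_iff[OF that(1) that(2) edge_subset] by metis
  qed auto
  have "bij_betw (\<lambda>\<psi>. \<lambda>v\<in>VF. ?g (\<psi> v)) ?fib (automorphisms VF EF)"
  proof (rule bij_betw_byWitness[where f' = "\<lambda>\<sigma>. \<lambda>v\<in>VF. \<phi> (\<sigma> v)"])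
    show "\<forall>\<psi>\<in>?fib. (\<lambda>v\<in>VF. \<phi> ((\<lambda>v\<in>VF. ?g (\<psi> v)) v)) = \<psi>"
    proof
      fix \<psi> assume \<psi>: "\<psi> \<in> ?fib"
      show "(\<lambda>v\<in>VF. \<phi> ((\<lambda>v\<in>VF. ?g (\<psi> v)) v)) = \<psi>"
      proof (rule extensionalityI[of _ VF])
        fix v assume "v \<in> VF"
        then show "(\<lambda>v\<in>VF. \<phi> ((\<lambda>v\<in>VF. ?g (\<psi> v)) v)) v = \<psi> v"
          using \<psi> fg[of "\<psi> v"] by auto
      qed (use \<psi> in \<open>auto simp: embeddings_def PiE_iff\<close>)
    qed
    show "\<forall>\<sigma>\<in>automorphisms VF EF. (\<lambda>v\<in>VF. ?g ((\<lambda>v\<in>VF. \<phi> (\<sigma> v)) v)) = \<sigma>"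
    proof
      fix \<sigma> assume \<sigma>: "\<sigma> \<in> automorphisms VF EF"
      show "(\<lambda>v\<in>VF. ?g ((\<lambda>v\<in>VF. \<phi> (\<sigma> v)) v)) = \<sigma>"
      proof (rule extensionalityI[of _ VF])
        fix v assume "v \<in> VF"
        moreover have "\<sigma> v \<in> VF" using \<sigma> \<open>v \<in> VF\<close> by (auto simp: automorphisms_def)
        ultimately show "(\<lambda>v\<in>VF. ?g ((\<lambda>v\<in>VF. \<phi> (\<sigma> v)) v)) v = \<sigma> v" by (simp add: gf)
      qed (use \<sigma> in \<open>auto simp: automorphisms_def PiE_iff\<close>)
    qed
    show "(\<lambda>\<psi>. \<lambda>v\<in>VF. ?g (\<psi> v)) ` ?fib \<subseteq> automorphisms VF EF"
    proof (rule image_subsetI)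
      fix \<psi> assume \<psi>: "\<psi> \<in> ?fib"
      then have inj': "inj_on \<psi> VF" and img: "\<psi> ` VF = \<phi> ` VF" and eimg: "(`) \<psi> ` EF = (`) \<phi> ` EF"
        by (auto simp: embeddings_def)
      let ?s = "\<lambda>v\<in>VF. ?g (\<psi> v)"
      have "bij_betw \<psi> VF (\<phi> ` VF)" using inj' img by (simp add: bij_betw_def)
      moreover have "bij_betw ?g (\<phi> ` VF) VF" using inj by (intro bij_betw_inv_into) (simp add: bij_betw_def)
      ultimately have "bij_betw (?g \<circ> \<psi>) VF VF" by (rule bij_betw_trans)
      then have "bij_betw ?s VF VF" by (rule bij_betw_cong[THEN iffD1, rotated]) simp
      moreover have "{x, y} \<in> EF \<longleftrightarrow> {?s x, ?s y} \<in> EF" if xy: "x \<in> VF" "y \<in> VF" for x y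
      proof -
        have "\<psi> x \<in> \<phi> ` VF" "\<psi> y \<in> \<phi> ` VF" using xy img by auto
        then have "\<psi> ` {x, y} = \<phi> ` {?s x, ?s y}" and "{?s x, ?s y} \<subseteq> VF"
          using xy by (simp_all add: fg gin)
        then show ?thesis
          using edge_iff[OF inj', of "{x, y}"] edge_iff[OF inj, of "{?s x, ?s y}"] xy eimg by simp
      qed
      ultimately show "?s \<in> automorphisms VF EF"
        using \<open>bij_betw ?s VF VF\<close> by (auto simp: automorphisms_def dest: bij_betwE)
    qed
    show "(\<lambda>\<sigma>. \<lambda>v\<in>VF. \<phi> (\<sigma> v)) ` automorphisms VF EF \<subseteq> ?fib"
    proof (rule image_subsetI)
      fix \<sigma> assume \<sigma>: "\<sigma> \<in> automorphisms VF EF"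
      then have bij: "bij_betw \<sigma> VF VF"
        and iff: "\<And>x y. x \<in> VF \<Longrightarrow> y \<in> VF \<Longrightarrow> {x, y} \<in> EF \<longleftrightarrow> {\<sigma> x, \<sigma> y} \<in> EF"
        by (auto simp: automorphisms_def)
      have \<sigma>in: "\<sigma> v \<in> VF" if "v \<in> VF" for v using bij that by (auto dest: bij_betwE)
      let ?p = "\<lambda>v\<in>VF. \<phi> (\<sigma> v)"
      \<comment> \<open>Surjectivity of \<open>\<sigma>\<close> on the vertices lifts the
        equivalence for pairs to equality of edge sets.\<close>
      have \<sigma>EF: "(`) \<sigma> ` EF = EF"
      proof (intro equalityI subsetI)
        fix e assume "e \<in> (`) \<sigma> ` EF"
        then obtain f where f: "f \<in> EF" "e = \<sigma> ` f" by auto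
        from f(1) obtain x y where "x \<in> VF" "y \<in> VF" "f = {x, y}" by (rule edge_cases)
        then show "e \<in> EF" using iff[of x y] f by simp
      next
        fix e assume "e \<in> EF"
        then obtain x y where xy: "x \<in> VF" "y \<in> VF" "e = {x, y}" by (auto elim: edge_cases)
        then have "x \<in> \<sigma> ` VF" "y \<in> \<sigma> ` VF" using bij by (simp_all add: bij_betw_def)
        then obtain x' y' where x'y': "x' \<in> VF" "y' \<in> VF" "x = \<sigma> x'" "y = \<sigma> y'"
          by blast
        then have "{x', y'} \<in> EF" "e = \<sigma> ` {x', y'}" using iff[of x' y'] \<open>e \<in> EF\<close> xy by auto
        then show "e \<in> (`) \<sigma> ` EF" by blast
      qed
      have p_img: "?p ` f = \<phi> ` \<sigma> ` f" if "f \<subseteq> VF" for f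
        unfolding image_image by (rule image_cong) (use that in auto)
      have pEF: "(`) ?p ` EF = (`) \<phi> ` EF"
      proof -
        have "(`) ?p ` EF = (\<lambda>e. \<phi> ` \<sigma> ` e) ` EF"
          by (intro image_cong refl p_img edge_subset)
        also have "\<dots> = (`) \<phi> ` (`) \<sigma> ` EF"
          by (simp only: image_image)
        finally show ?thesis by (simp only: \<sigma>EF)
      qed
      moreover have "?p ` VF = \<phi> ` VF"
        using p_img[of VF] bij by (simp add: bij_betw_def)
      moreover have "inj_on ?p VF"
      proof -
        have "inj_on (\<phi> \<circ> \<sigma>) VF"
          using bij inj by (intro comp_inj_on) (auto simp: bij_betw_def)
        then show ?thesis by (rule inj_on_cong[THEN iffD1, rotated]) simp
      qed
      moreover have "?p \<in> VF \<rightarrow>\<^sub>E V"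
        using \<phi> \<sigma>in by (auto simp: embeddings_def)
      moreover have "?p ` e \<in> E" if "e \<in> EF" for e
      proof -
        have "?p ` e \<in> (`) ?p ` EF" using that by blast
        then show ?thesis unfolding pEF using \<phi> by (auto simp: embeddings_def)
      qed
      ultimately have "?p \<in> embeddings VF EF V E"
        unfolding embeddings_def by (intro CollectI conjI ballI)
      with \<open>?p ` VF = \<phi> ` VF\<close> pEF show "?p \<in> ?fib"
        by (intro CollectI conjI)
    qed
  qed
  then show ?thesis by (rule bij_betw_same_card)
qed

lemma card_embeddings:
  assumes "finite V" "finite E"
  shows "card (embeddings VF EF V E) = card (automorphisms VF EF) * card (copies VF EF V E)"
proof -
  let ?h = "\<lambda>\<phi>. (\<phi> ` VF, (`) \<phi> ` EF)"
  have fin: "finite (embeddings VF EF V E)"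
    by (rule finite_subset[of _ "VF \<rightarrow>\<^sub>E V"]) (auto simp: embeddings_def assms intro!: finite_PiE)
  have "?h ` embeddings VF EF V E = copies VF EF V E"
  proof (intro equalityI subsetI)
    fix c assume "c \<in> ?h ` embeddings VF EF V E"
    then show "c \<in> copies VF EF V E" by (auto simp: embeddings_def copies_def bij_betw_def)
  next
    fix c assume "c \<in> copies VF EF V E"
    then obtain \<phi> where \<phi>: "bij_betw \<phi> VF (fst c)" "snd c = (`) \<phi> ` EF" "fst c \<subseteq> V" "snd c \<subseteq> E"
      by (rule copiesE)
    let ?p = "restrict \<phi> VF"
    have img: "?p ` e = \<phi> ` e" if "e \<subseteq> VF" for e using that by (force simp: subset_iff)
    have "?p ` e \<in> E" if "e \<in> EF" for e
      unfolding img[OF edge_subset[OF that]] using \<phi> that by auto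
    moreover have "inj_on ?p VF"
      using \<phi>(1) by (auto simp: bij_betw_def inj_on_def)
    moreover have "?p \<in> VF \<rightarrow>\<^sub>E V"
      using \<phi>(1,3) by (auto simp: bij_betw_def)
    ultimately have emb: "?p \<in> embeddings VF EF V E"
      by (simp add: embeddings_def)
    have "(`) ?p ` EF = (`) \<phi> ` EF"
      by (intro image_cong refl img edge_subset)
    then have h: "c = ?h ?p"
      using \<phi> img[of VF] by (simp add: prod_eq_iff bij_betw_def)
    show "c \<in> ?h ` embeddings VF EF V E"
      by (rule image_eqI[where x = ?p]) (rule h, rule emb)
  qed
  then have "card (embeddings VF EF V E) = (\<Sum>c\<in>copies VF EF V E. card {\<psi> \<in> embeddings VF EF V E. ?h \<psi> = c})"
    using sum.image_gen[OF fin, of "\<lambda>_. 1::nat" ?h] by simp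
  also have "\<dots> = (\<Sum>c\<in>copies VF EF V E. card (automorphisms VF EF))"
  proof (rule sum.cong[OF refl])
    fix c assume "c \<in> copies VF EF V E"
    then obtain \<phi> where \<phi>: "\<phi> \<in> embeddings VF EF V E" "c = ?h \<phi>"
      using \<open>?h ` embeddings VF EF V E = copies VF EF V E\<close> by (metis (no_types, lifting) imageE)
    then show "card {\<psi> \<in> embeddings VF EF V E. ?h \<psi> = c} = card (automorphisms VF EF)"
      using card_embeddings_fibre[OF \<phi>(1)] by simp
  qed
  finally show ?thesis by simp
qed

end

section \<open>Binomial moments of the number of copies\<close>

text \<open>\<open>G_p\<close> over an arbitrary ground set, which keeps the moment estimates
  independent of the distance graph.\<close>

definition random_subset_pmf :: "'b set \<Rightarrow> real \<Rightarrow> 'b set pmf" where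
  "random_subset_pmf E p = map_pmf (\<lambda>\<omega>. {e \<in> E. \<omega> e}) (Pi_pmf E False (\<lambda>_. bernoulli_pmf p))"

lemma set_random_subset_pmf: "set_pmf (random_subset_pmf E p) \<subseteq> Pow E"
  by (auto simp: random_subset_pmf_def)

lemma prob_subset_random_subset:
  assumes "finite E" "D \<subseteq> E" "0 \<le> p" "p \<le> 1"
  shows "measure_pmf.prob (random_subset_pmf E p) {E'. D \<subseteq> E'} = p ^ card D"
proof -
  let ?B = "\<lambda>e. if e \<in> D then {True} else UNIV"
  have "(\<lambda>\<omega>. {e \<in> E. \<omega> e}) -` {E'. D \<subseteq> E'} = Pi E ?B"
    using assms(2) by (auto simp: Pi_def)
  then have "measure_pmf.prob (random_subset_pmf E p) {E'. D \<subseteq> E'} =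
      measure_pmf.prob (Pi_pmf E False (\<lambda>_. bernoulli_pmf p)) (Pi E ?B)"
    by (simp add: random_subset_pmf_def)
  also have "\<dots> = (\<Prod>e\<in>E. measure_pmf.prob (bernoulli_pmf p) (?B e))"
    by (rule measure_Pi_pmf_Pi) (use assms in auto)
  also have "\<dots> = (\<Prod>e\<in>E. if e \<in> D then p else 1)"
    using assms by (intro prod.cong refl) (simp add: measure_pmf_single)
  also have "\<dots> = p ^ card (E \<inter> D)"
    using assms(1) by (simp add: prod.If_cases)
  also have "E \<inter> D = D" using assms(2) by auto
  finally show ?thesis .
qed

text \<open>The sets of each fixed size contribute at most 1 in total.\<close>

lemma sum_inverse_power_small_subsets_le:
  assumes "finite V" "V \<noteq> {}"
  shows "(\<Sum>Z | Z \<subseteq> V \<and> card Z \<le> b. 1 / real (card V) ^ card Z) \<le> real b + 1"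
proof -
  have "(\<Sum>Z | Z \<subseteq> V \<and> card Z \<le> b. 1 / real (card V) ^ card Z) =
      (\<Sum>j\<in>{..b}. \<Sum>Z\<in>{Z \<in> {Z. Z \<subseteq> V \<and> card Z \<le> b}. card Z = j}. 1 / real (card V) ^ card Z)"
    by (rule sum.group[symmetric]) (use assms in auto)
  also have "\<dots> = (\<Sum>j\<le>b. real (card V choose j) / real (card V) ^ j)"
  proof (rule sum.cong[OF refl])
    fix j assume j: "j \<in> {..b}"
    have "(\<Sum>Z\<in>{Z \<in> {Z. Z \<subseteq> V \<and> card Z \<le> b}. card Z = j}. 1 / real (card V) ^ card Z) =
        (\<Sum>Z | Z \<subseteq> V \<and> card Z = j. 1 / real (card V) ^ j)"
      using j by (intro sum.cong) auto
    then show "(\<Sum>Z\<in>{Z \<in> {Z. Z \<subseteq> V \<and> card Z \<le> b}. card Z = j}. 1 / real (card V) ^ card Z) =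
        real (card V choose j) / real (card V) ^ j"
      using assms by (simp add: n_subsets)
  qed
  also have "\<dots> \<le> (\<Sum>j\<le>b. 1)"
  proof (rule sum_mono)
    fix j
    have "card V choose j \<le> card V ^ j"
      by (cases "j \<le> card V") (auto simp: binomial_le_pow binomial_eq_0)
    then have "real (card V choose j) \<le> real (card V) ^ j"
      by (simp flip: of_nat_power)
    then show "real (card V choose j) / real (card V) ^ j \<le> 1"
      using assms by (simp add: divide_le_eq card_gt_0_iff)
  qed
  finally show ?thesis by simp
qed

context finite_simple_graph
begin

lemma fst_copy_subset: "c \<in> copies VF EF V E \<Longrightarrow> fst c \<subseteq> V"
  by (erule copiesE)

lemma snd_copy_subset: "c \<in> copies VF EF V E \<Longrightarrow> snd c \<subseteq> E"
  by (erule copiesE)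

lemma copies_mono_eq: "E' \<subseteq> E \<Longrightarrow> copies VF EF V E' = {c \<in> copies VF EF V E. snd c \<subseteq> E'}"
  by (auto simp: copies_def)

text \<open>The binomial coefficient counts the \<open>r\<close>-sets of copies that are present,
  and such a set is present exactly when the union of its edge sets is.\<close>

lemma expectation_num_copies_choose:
  assumes "finite V" "finite E" "0 \<le> p" "p \<le> 1"
  shows "measure_pmf.expectation (random_subset_pmf E p) (\<lambda>E'. real (num_copies VF EF V E' choose r)) =
    (\<Sum>S | S \<subseteq> copies VF EF V E \<and> card S = r. p ^ card (\<Union>(snd ` S)))"
proof -
  let ?C = "copies VF EF V E" and ?q = "measure_pmf (random_subset_pmf E p)"
  have fin: "finite ?C" using assms finite_copies by blast
  then have finS: "finite {S. S \<subseteq> ?C \<and> card S = r}" by simp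
  have eq: "real (num_copies VF EF V E' choose r) =
      (\<Sum>S | S \<subseteq> ?C \<and> card S = r. indicator {E'. \<Union>(snd ` S) \<subseteq> E'} E')" if "E' \<subseteq> E" for E'
  proof -
    have "num_copies VF EF V E' choose r = card {S. S \<subseteq> {c \<in> ?C. snd c \<subseteq> E'} \<and> card S = r}"
      using n_subsets[of "{c \<in> ?C. snd c \<subseteq> E'}" r] fin by (simp add: num_copies_def copies_mono_eq[OF that])
    also have "{S. S \<subseteq> {c \<in> ?C. snd c \<subseteq> E'} \<and> card S = r} =
        {S \<in> {S. S \<subseteq> ?C \<and> card S = r}. \<Union>(snd ` S) \<subseteq> E'}"
      by auto
    finally show ?thesis using finS by (simp add: indicator_def sum.If_cases Int_def of_bool_def)
  qed
  have "(\<integral>E'. real (num_copies VF EF V E' choose r) \<partial>?q) =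
      (\<integral>E'. (\<Sum>S | S \<subseteq> ?C \<and> card S = r. indicator {E'. \<Union>(snd ` S) \<subseteq> E'} E') \<partial>?q)"
    using set_random_subset_pmf[of E p] by (intro integral_cong_AE) (auto simp: AE_measure_pmf_iff eq)
  also have "\<dots> = (\<Sum>S | S \<subseteq> ?C \<and> card S = r. measure_pmf.prob (random_subset_pmf E p) {E'. \<Union>(snd ` S) \<subseteq> E'})"
    by (subst Bochner_Integration.integral_sum) (auto intro!: measure_pmf.integrable_const_bound[where B = 1])
  also have "\<dots> = (\<Sum>S | S \<subseteq> ?C \<and> card S = r. p ^ card (\<Union>(snd ` S)))"
  proof (intro sum.cong refl prob_subset_random_subset assms)
    fix S assume "S \<in> {S. S \<subseteq> ?C \<and> card S = r}"
    then have "snd c \<subseteq> E" if "c \<in> S" for c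
      using that by (intro snd_copy_subset) auto
    then show "\<Union>(snd ` S) \<subseteq> E" by (rule UN_least)
  qed
  finally show ?thesis .
qed

text \<open>Edges are nonempty subsets of the vertex sets, so vertex-disjoint copies share no
  edge.\<close>

lemma card_union_disjoint_copies:
  assumes "finite S" "S \<subseteq> copies VF EF V E" "\<And>c d. c \<in> S \<Longrightarrow> d \<in> S \<Longrightarrow> c \<noteq> d \<Longrightarrow> fst c \<inter> fst d = {}"
  shows "card (\<Union>(snd ` S)) = card S * card EF"
proof -
  have "card (\<Union>c\<in>S. snd c) = (\<Sum>c\<in>S. card (snd c))"
  proof (rule card_UN_disjoint)
    show "\<forall>c\<in>S. finite (snd c)" using assms finite_snd_copy by blast
    show "\<forall>c\<in>S. \<forall>d\<in>S. c \<noteq> d \<longrightarrow> snd c \<inter> snd d = {}"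
    proof (intro ballI impI)
      fix c d assume cd: "c \<in> S" "d \<in> S" "c \<noteq> d"
      then have "c \<in> copies VF EF V E" "d \<in> copies VF EF V E" using assms by auto
      then have "e \<subseteq> fst c \<inter> fst d" "e \<noteq> {}" if "e \<in> snd c \<inter> snd d" for e
        using that copy_edge_subset[of c V E e] copy_edge_subset[of d V E e] by auto
      then show "snd c \<inter> snd d = {}" using assms(3)[OF cd] by blast
    qed
  qed (use assms in auto)
  also have "\<dots> = (\<Sum>c\<in>S. card EF)"
    using assms card_snd_copy by (intro sum.cong refl) blast
  finally show ?thesis by simp
qed

lemma card_union_copies_le:
  assumes "finite S" "S \<subseteq> copies VF EF V E"
  shows "card (\<Union>(snd ` S)) \<le> card S * card EF" "card (\<Union>(fst ` S)) \<le> card S * card VF"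
proof -
  have "card (\<Union>(snd ` S)) \<le> (\<Sum>c\<in>S. card (snd c))" "card (\<Union>(fst ` S)) \<le> (\<Sum>c\<in>S. card (fst c))"
    using assms by (auto intro: card_UN_le)
  moreover have "(\<Sum>c\<in>S. card (snd c)) = (\<Sum>c\<in>S. card EF)" "(\<Sum>c\<in>S. card (fst c)) = (\<Sum>c\<in>S. card VF)"
    using assms card_snd_copy card_fst_copy by (intro sum.cong refl; blast)+
  ultimately show "card (\<Union>(snd ` S)) \<le> card S * card EF" "card (\<Union>(fst ` S)) \<le> card S * card VF"
    by simp_all
qed

text \<open>Each copy on a vertex set \<open>Z\<close> with at most \<open>b\<close> elements lies in \<open>Pow Z \<times> Pow (Pow Z)\<close>.\<close>

definition family_bound :: "nat \<Rightarrow> real" where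
  "family_bound b = 2 ^ (2 ^ b * 2 ^ (2 ^ b))"

text \<open>Group the families by the vertex set they span: the weight depends on this set alone,
  and the number of families in a group is bounded independently of \<open>V\<close>.\<close>

lemma sum_inverse_power_families_le:
  assumes "finite V" "V \<noteq> {}" "finite E"
  shows "(\<Sum>S | S \<subseteq> copies VF EF V E \<and> card S = r. 1 / real (card V) ^ card (\<Union>(fst ` S))) \<le>
    family_bound (r * card VF) * (real (r * card VF) + 1)"
proof -
  let ?C = "copies VF EF V E" and ?b = "r * card VF"
  let ?F = "{S. S \<subseteq> ?C \<and> card S = r}" and ?u = "\<lambda>S. \<Union>(fst ` S)"
  have finC: "finite ?C" using assms finite_copies by blast
  then have fin: "finite ?F" by simp
  have img: "?u ` ?F \<subseteq> {Z. Z \<subseteq> V \<and> card Z \<le> ?b}"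
  proof (rule image_subsetI)
    fix S assume S: "S \<in> ?F"
    then have "finite S" using finC finite_subset by blast
    then have "card (?u S) \<le> ?b" using card_union_copies_le(2)[of S V E] S by auto
    moreover have "?u S \<subseteq> V" using S by (intro UN_least fst_copy_subset) auto
    ultimately show "?u S \<in> {Z. Z \<subseteq> V \<and> card Z \<le> ?b}" by simp
  qed
  have finZ: "finite {Z. Z \<subseteq> V \<and> card Z \<le> ?b}" using assms by simp
  have fibre: "real (card {S \<in> ?F. ?u S = Z}) \<le> family_bound ?b" if Z: "Z \<subseteq> V" "card Z \<le> ?b" for Z
  proof -
    have "finite Z" using Z assms finite_subset by blast
    have "{S \<in> ?F. ?u S = Z} \<subseteq> Pow (Pow Z \<times> Pow (Pow Z))"
    proof safe
      fix S W D assume S: "S \<subseteq> ?C" "(W, D) \<in> S" "Z = ?u S"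
      show "x \<in> ?u S" if "x \<in> W" for x using that S by force
      fix e x assume "e \<in> D" "x \<in> e"
      then have "x \<in> W" using copy_edge_subset(1)[of "(W, D)" V E e] S by auto
      then show "x \<in> ?u S" using S by force
    qed
    then have "card {S \<in> ?F. ?u S = Z} \<le> card (Pow (Pow Z \<times> Pow (Pow Z)))"
      using \<open>finite Z\<close> by (intro card_mono) auto
    also have "\<dots> = 2 ^ (2 ^ card Z * 2 ^ (2 ^ card Z))"
      using \<open>finite Z\<close> by (simp add: card_Pow card_cartesian_product)
    also have "\<dots> \<le> 2 ^ (2 ^ ?b * 2 ^ (2 ^ ?b))"
      using Z by (intro power_increasing mult_mono) auto
    finally have "real (card {S \<in> ?F. ?u S = Z}) \<le> real (2 ^ (2 ^ ?b * 2 ^ (2 ^ ?b)))"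
      by (simp only: of_nat_le_iff)
    then show ?thesis by (simp add: family_bound_def)
  qed
  have "(\<Sum>S\<in>?F. 1 / real (card V) ^ card (?u S)) =
      (\<Sum>Z\<in>{Z. Z \<subseteq> V \<and> card Z \<le> ?b}. \<Sum>S\<in>{S \<in> ?F. ?u S = Z}. 1 / real (card V) ^ card (?u S))"
    by (rule sum.group[OF fin finZ img, symmetric])
  also have "\<dots> = (\<Sum>Z | Z \<subseteq> V \<and> card Z \<le> ?b. real (card {S \<in> ?F. ?u S = Z}) * (1 / real (card V) ^ card Z))"
    by (intro sum.cong refl) simp
  also have "\<dots> \<le> (\<Sum>Z | Z \<subseteq> V \<and> card Z \<le> ?b. family_bound ?b * (1 / real (card V) ^ card Z))"
    by (intro sum_mono mult_right_mono fibre) auto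
  also have "\<dots> = family_bound ?b * (\<Sum>Z | Z \<subseteq> V \<and> card Z \<le> ?b. 1 / real (card V) ^ card Z)"
    by (simp add: sum_distrib_left)
  also have "\<dots> \<le> family_bound ?b * (real ?b + 1)"
    by (intro mult_left_mono sum_inverse_power_small_subsets_le assms) (simp add: family_bound_def)
  finally show ?thesis .
qed

text \<open>Substituting \<open>p = q * N powr (- k / l)\<close> turns \<open>p ^ e * N ^ v\<close>
  into \<open>q ^ e * N powr (v - k e / l)\<close>.\<close>

lemma power_excess_le:
  fixes N p :: real
  assumes N: "N \<ge> 1" and p: "p \<ge> 0" and l: "card EF \<ge> 1" and e: "e \<le> r * card EF"
    and excess: "card EF * v < card VF * e"
  shows "p ^ e \<le> (1 + p * N powr (card VF / card EF)) ^ (r * card EF) * N powr (- 1 / card EF) * (1 / N ^ v)"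
proof -
  let ?k = "real (card VF)" and ?l = "real (card EF)"
  define q where "q = p * N powr (?k / ?l)"
  have q: "q \<ge> 0" using p by (simp add: q_def)
  have "p = q * N powr (- ?k / ?l)"
    using N by (simp add: q_def mult.assoc flip: powr_add)
  then have "p ^ e * N ^ v = q ^ e * (N powr (- ?k / ?l)) ^ e * N ^ v"
    by (simp add: power_mult_distrib)
  also have "(N powr (- ?k / ?l)) ^ e = N powr (- ?k / ?l * real e)"
    using N by (simp add: powr_powr flip: powr_realpow)
  also have "q ^ e * N powr (- ?k / ?l * real e) * N ^ v = q ^ e * N powr (real v - ?k / ?l * real e)"
    using N by (simp add: powr_realpow[symmetric] mult.assoc flip: powr_add)
  also have "\<dots> \<le> (1 + q) ^ (r * card EF) * N powr (- 1 / ?l)"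
  proof (rule mult_mono)
    \<comment> \<open>With \<open>1 + q\<close> in place of \<open>q\<close> the exponent may be
      raised to a common value even when \<open>q\<close> is below 1.\<close>
    have "q ^ e \<le> (1 + q) ^ e" using q by (intro power_mono) auto
    also have "\<dots> \<le> (1 + q) ^ (r * card EF)" using q e by (intro power_increasing) auto
    finally show "q ^ e \<le> (1 + q) ^ (r * card EF)" .
    \<comment> \<open>Integrality turns the strict inequality into a gap of 1, which becomes the
      exponent \<open>- 1 / l\<close>.\<close>
    have "real (card EF * v + 1) \<le> real (card VF * e)"
      unfolding of_nat_le_iff using excess by simp
    then have "?l * real v + 1 \<le> ?k * real e" by simp
    then have "real v - ?k / ?l * real e \<le> - 1 / ?l"
      using l by (simp add: field_simps)
    then show "N powr (real v - ?k / ?l * real e) \<le> N powr (- 1 / ?l)"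
      using N by (intro powr_mono) auto
  qed (use q in auto)
  finally show ?thesis using N by (simp add: q_def field_simps)
qed

text \<open>Vertex-disjoint families have exactly \<open>r * card EF\<close> edges and cancel in the
  difference; the error comes from overlapping families only.\<close>

theorem expectation_num_copies_choose_approx:
  assumes sb: "strictly_balanced VF EF" and l: "card EF \<ge> 1"
    and V: "finite V" "V \<noteq> {}" and E: "finite E" and p: "0 \<le> p" "p \<le> 1"
  shows "\<bar>measure_pmf.expectation (random_subset_pmf E p) (\<lambda>E'. real (num_copies VF EF V E' choose r)) -
      p ^ (r * card EF) * real (card (copies VF EF V E) choose r)\<bar> \<le>
    family_bound (r * card VF) * (real (r * card VF) + 1) *
      ((1 + p * real (card V) powr (card VF / card EF)) ^ (r * card EF) * real (card V) powr (- 1 / card EF))"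
proof -
  let ?C = "copies VF EF V E"
  let ?F = "{S. S \<subseteq> ?C \<and> card S = r}"
  let ?A = "(1 + p * real (card V) powr (card VF / card EF)) ^ (r * card EF) * real (card V) powr (- 1 / card EF)"
  have finC: "finite ?C" using V E finite_copies by blast
  have N: "real (card V) \<ge> 1" using V by (simp add: Suc_leI card_gt_0_iff)
  have term_le: "\<bar>p ^ card (\<Union>(snd ` S)) - p ^ (r * card EF)\<bar> \<le> ?A * (1 / real (card V) ^ card (\<Union>(fst ` S)))"
    if S: "S \<in> ?F" for S
  proof -
    have S': "S \<subseteq> ?C" "card S = r" "finite S" using S finC finite_subset by auto
    have e: "card (\<Union>(snd ` S)) \<le> r * card EF" using card_union_copies_le(1)[OF S'(3,1)] S'(2) by simp
    show ?thesis
    proof (cases "\<exists>c\<in>S. \<exists>d\<in>S. c \<noteq> d \<and> fst c \<inter> fst d \<noteq> {}")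
      case True
      then obtain c d where cd: "c \<in> S" "d \<in> S" "c \<noteq> d" "fst c \<inter> fst d \<noteq> {}" by blast
      \<comment> \<open>Overlaps can only reduce the number of edges, so the subtracted power is the
        smaller one.\<close>
      have "p ^ (r * card EF) \<le> p ^ card (\<Union>(snd ` S))"
        using e p by (intro power_decreasing) auto
      then have "\<bar>p ^ card (\<Union>(snd ` S)) - p ^ (r * card EF)\<bar> \<le> p ^ card (\<Union>(snd ` S))"
        using p by simp
      also have "\<dots> \<le> ?A * (1 / real (card V) ^ card (\<Union>(fst ` S)))"
        by (rule power_excess_le[OF N p(1) l e overlapping_copies_excess[OF sb S'(3,1) cd]])
      finally show ?thesis .
    next
      case False
      then have "card (\<Union>(snd ` S)) = r * card EF"
        using card_union_disjoint_copies[OF S'(3,1)] S'(2) by blast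
      then show ?thesis using p by simp
    qed
  qed
  have "p ^ (r * card EF) * real (card ?C choose r) = (\<Sum>S\<in>?F. p ^ (r * card EF))"
    using n_subsets[OF finC, of r] by simp
  then have "measure_pmf.expectation (random_subset_pmf E p) (\<lambda>E'. real (num_copies VF EF V E' choose r)) -
      p ^ (r * card EF) * real (card ?C choose r) = (\<Sum>S\<in>?F. p ^ card (\<Union>(snd ` S)) - p ^ (r * card EF))"
    unfolding expectation_num_copies_choose[OF V(1) E p] by (simp only: sum_subtractf)
  also have "\<bar>\<dots>\<bar> \<le> (\<Sum>S\<in>?F. \<bar>p ^ card (\<Union>(snd ` S)) - p ^ (r * card EF)\<bar>)"
    by (rule sum_abs)
  also have "\<dots> \<le> (\<Sum>S\<in>?F. ?A * (1 / real (card V) ^ card (\<Union>(fst ` S))))"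
    by (intro sum_mono term_le)
  also have "\<dots> = ?A * (\<Sum>S\<in>?F. 1 / real (card V) ^ card (\<Union>(fst ` S)))"
    by (simp add: sum_distrib_left)
  also have "\<dots> \<le> ?A * (family_bound (r * card VF) * (real (r * card VF) + 1))"
    using p by (intro mult_left_mono sum_inverse_power_families_le V E) auto
  finally show ?thesis by (simp only: mult.commute)
qed

end

section \<open>Asymptotics of the central binomial coefficients\<close>

text \<open>Expresses the Wallis product through the central binomial coefficient, whose asymptotics
  including the constant then follow from Wallis's limit.\<close>

lemma wallis_prod_central_binomial:
  "(\<Prod>k=1..n. (4 * real k ^ 2) / (4 * real k ^ 2 - 1)) = 16 ^ n / (real ((2 * n) choose n) ^ 2 * (2 * real n + 1))"
proof (induction n)
  case (Suc n)
  have "Suc n * (2 * Suc n choose Suc n) = 2 * (2 * n + 1) * (2 * n choose n)"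
  proof -
    have a: "Suc n * (Suc (2 * n + 1) choose Suc n) = Suc (2 * n + 1) * (2 * n + 1 choose n)"
      using Suc_times_binomial_eq[of "2 * n + 1" n] by (metis mult.commute)
    have b: "Suc n * (2 * n + 1 choose n) = (2 * n + 1) * (2 * n choose n)"
      using binomial_absorb_comp[of "2 * n + 1" n] by simp
    have "Suc n * (Suc n * (Suc (2 * n + 1) choose Suc n)) = Suc (2 * n + 1) * (Suc n * (2 * n + 1 choose n))"
      unfolding a by (rule mult.left_commute)
    also have "\<dots> = Suc n * (2 * (2 * n + 1) * (2 * n choose n))"
      unfolding b by simp
    finally have "Suc n * (Suc (2 * n + 1) choose Suc n) = 2 * (2 * n + 1) * (2 * n choose n)"
      by (simp only: mult_cancel1) blast
    moreover have "Suc (2 * n + 1) = 2 * Suc n" by simp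
    ultimately show ?thesis by (simp only:)
  qed
  then have "real (Suc n) * real (2 * Suc n choose Suc n) = real (2 * (2 * n + 1)) * real (2 * n choose n)"
    by (simp only: of_nat_mult[symmetric])
  moreover have "real (Suc n) = real n + 1" "real (2 * (2 * n + 1)) = 2 * (2 * real n + 1)"
    by simp_all
  ultimately have mult: "(real n + 1) * real (2 * Suc n choose Suc n) = 2 * (2 * real n + 1) * real (2 * n choose n)"
    by (simp only:)
  have div: "z = y / x * b" if "x * z = y * b" "x \<noteq> 0" for x y z b :: real
    using that by (simp add: field_simps)
  have C: "real (2 * Suc n choose Suc n) = 2 * (2 * real n + 1) / (real n + 1) * real (2 * n choose n)"
    by (rule div[OF mult]) linarith
  have "(\<Prod>k=1..Suc n. (4 * real k ^ 2) / (4 * real k ^ 2 - 1)) =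
      16 ^ n / (real ((2 * n) choose n) ^ 2 * (2 * real n + 1)) * ((4 * real (Suc n) ^ 2) / (4 * real (Suc n) ^ 2 - 1))"
    using Suc by simp
  also have "4 * real (Suc n) ^ 2 - 1 = (2 * real n + 1) * (2 * real n + 3)"
    by (simp add: power2_eq_square algebra_simps)
  also have "16 ^ n / (real ((2 * n) choose n) ^ 2 * (2 * real n + 1)) * ((4 * real (Suc n) ^ 2) / ((2 * real n + 1) * (2 * real n + 3)))
     = 16 ^ Suc n / ((2 * (2 * real n + 1) / (real n + 1) * real (2 * n choose n)) ^ 2 * (2 * real (Suc n) + 1))"
  proof -
    define B where "B = real (2 * n choose n)"
    define x where "x = real n"
    have "B > 0" "x \<ge> 0" by (auto simp: B_def x_def)
    then show ?thesis
      unfolding B_def[symmetric] of_nat_Suc x_def[symmetric]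
      by (simp add: divide_simps power2_eq_square) (simp add: algebra_simps)
  qed
  finally show ?case unfolding C .
qed simp

lemma central_binomial_tendsto:
  "(\<lambda>n. real ((2 * n) choose n) * sqrt (real n) / 4 ^ n) \<longlonglongrightarrow> 1 / sqrt pi"
proof -
  have "(\<lambda>n. inverse (16 ^ n / (real ((2 * n) choose n) ^ 2 * (2 * real n + 1)))) \<longlonglongrightarrow> inverse (pi / 2)"
    using wallis unfolding wallis_prod_central_binomial by (intro tendsto_inverse) auto
  moreover have "(\<lambda>n. real n / (2 * real n + 1)) \<longlonglongrightarrow> 1 / 2"
    by real_asymp
  ultimately have "(\<lambda>n. inverse (16 ^ n / (real ((2 * n) choose n) ^ 2 * (2 * real n + 1))) * (real n / (2 * real n + 1)))
      \<longlonglongrightarrow> inverse (pi / 2) * (1 / 2)"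
    by (rule tendsto_mult)
  then have "(\<lambda>n. sqrt (inverse (16 ^ n / (real ((2 * n) choose n) ^ 2 * (2 * real n + 1))) * (real n / (2 * real n + 1))))
      \<longlonglongrightarrow> sqrt (inverse (pi / 2) * (1 / 2))"
    by (rule tendsto_real_sqrt)
  also have "inverse (pi / 2) * (1 / 2) = 1 / pi" by simp
  also have "(\<lambda>n. sqrt (inverse (16 ^ n / (real ((2 * n) choose n) ^ 2 * (2 * real n + 1))) * (real n / (2 * real n + 1)))) =
      (\<lambda>n. real ((2 * n) choose n) * sqrt (real n) / 4 ^ n)"
  proof
    fix n
    have "inverse (16 ^ n / (real ((2 * n) choose n) ^ 2 * (2 * real n + 1))) * (real n / (2 * real n + 1)) =
        real ((2 * n) choose n) ^ 2 * real n / 16 ^ n"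
    proof -
      have "2 * real n + 1 \<noteq> 0" by linarith
      then show ?thesis by (simp add: inverse_eq_divide)
    qed
    also have "\<dots> = real ((2 * n) choose n) ^ 2 * real n / (4 ^ n) ^ 2"
      by (simp add: power2_eq_square[of "4 ^ n"] flip: power_mult_distrib)
    finally have eq: "inverse (16 ^ n / (real ((2 * n) choose n) ^ 2 * (2 * real n + 1))) * (real n / (2 * real n + 1)) =
        real ((2 * n) choose n) ^ 2 * real n / (4 ^ n) ^ 2" .
    show "sqrt (inverse (16 ^ n / (real ((2 * n) choose n) ^ 2 * (2 * real n + 1))) * (real n / (2 * real n + 1))) =
      real ((2 * n) choose n) * sqrt (real n) / 4 ^ n"
      unfolding eq by (simp only: real_sqrt_mult real_sqrt_divide real_sqrt_abs) simp
  qed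
  finally show ?thesis by (simp add: real_sqrt_divide)
qed

lemma dg_N_pos: "dg_N n > 0"
  by (simp add: dg_N_def)

lemma dg_N1_pos: "dg_N1 n > 0"
  by (simp add: dg_N1_def)

lemma dg_N_tendsto: "(\<lambda>m. dg_N (4 * m) * sqrt (real m) / 16 ^ m) \<longlonglongrightarrow> 1 / sqrt (2 * pi)"
proof -
  have "filterlim (\<lambda>m. 2 * m) sequentially sequentially"
    by (rule filterlim_subseq) (auto simp: strict_mono_def)
  with central_binomial_tendsto have
    "(\<lambda>m. real ((2 * (2 * m)) choose (2 * m)) * sqrt (real (2 * m)) / 4 ^ (2 * m)) \<longlonglongrightarrow> 1 / sqrt pi"
    by (rule filterlim_compose)
  then have "(\<lambda>m. real ((2 * (2 * m)) choose (2 * m)) * sqrt (real (2 * m)) / 4 ^ (2 * m) / sqrt 2) \<longlonglongrightarrow> 1 / sqrt pi / sqrt 2"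
    by (rule tendsto_divide[OF _ tendsto_const]) simp
  moreover have "real ((2 * (2 * m)) choose (2 * m)) * sqrt (real (2 * m)) / 4 ^ (2 * m) / sqrt 2 =
      dg_N (4 * m) * sqrt (real m) / 16 ^ m" for m
    by (simp add: dg_N_def real_sqrt_mult power_mult)
  ultimately show ?thesis by (simp add: real_sqrt_mult mult.commute)
qed

lemma dg_N1_tendsto: "(\<lambda>m. dg_N1 (4 * m) * real m / 16 ^ m) \<longlonglongrightarrow> 1 / pi"
proof -
  have "(\<lambda>m. (real ((2 * m) choose m) * sqrt (real m) / 4 ^ m) ^ 2) \<longlonglongrightarrow> (1 / sqrt pi) ^ 2"
    by (intro tendsto_power central_binomial_tendsto)
  moreover have "(real ((2 * m) choose m) * sqrt (real m) / 4 ^ m) ^ 2 = dg_N1 (4 * m) * real m / 16 ^ m" for m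
  proof -
    have "(16::real) ^ m = (4 ^ m) ^ 2"
      by (simp add: power2_eq_square flip: power_mult_distrib)
    then show ?thesis by (simp add: dg_N1_def power_mult_distrib power_divide)
  qed
  ultimately show ?thesis by (simp add: power_divide)
qed

text \<open>The edge density is of order \<open>1 / sqrt m\<close> while \<open>dg_N (4 * m)\<close>
  grows like \<open>16 ^ m / sqrt m\<close>; hence \<open>N / N1\<close> is polylogarithmic in
  \<open>N\<close>.\<close>

lemma dg_density_tendsto:
  "(\<lambda>m. sqrt (real m) * (dg_N1 (4 * m) / dg_N (4 * m))) \<longlonglongrightarrow> sqrt (2 / pi)"
proof -
  have "(\<lambda>m. (dg_N1 (4 * m) * real m / 16 ^ m) / (dg_N (4 * m) * sqrt (real m) / 16 ^ m)) \<longlonglongrightarrow> (1 / pi) / (1 / sqrt (2 * pi))"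
    by (intro tendsto_divide dg_N_tendsto dg_N1_tendsto) simp
  also have "(1 / pi) / (1 / sqrt (2 * pi)) = sqrt (2 / pi)"
  proof -
    have "sqrt (2 * pi) = sqrt 2 * sqrt pi" "pi = sqrt pi * sqrt pi" by (simp_all add: real_sqrt_mult)
    then show ?thesis by (simp add: real_sqrt_divide divide_simps)
  qed
  also have "(\<lambda>m. (dg_N1 (4 * m) * real m / 16 ^ m) / (dg_N (4 * m) * sqrt (real m) / 16 ^ m)) =
      (\<lambda>m. sqrt (real m) * (dg_N1 (4 * m) / dg_N (4 * m)))"
  proof
    fix m
    have "real m = sqrt (real m) * sqrt (real m)" by simp
    then show "(dg_N1 (4 * m) * real m / 16 ^ m) / (dg_N (4 * m) * sqrt (real m) / 16 ^ m) =
        sqrt (real m) * (dg_N1 (4 * m) / dg_N (4 * m))"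
      using dg_N_pos[of "4 * m"] by (cases "m = 0") (simp_all add: field_simps)
  qed
  finally show ?thesis .
qed

lemma power_dg_N_powr_tendsto_0:
  assumes "b > 0"
  shows "(\<lambda>m. sqrt (real m) ^ a * dg_N (4 * m) powr (- b)) \<longlonglongrightarrow> 0"
proof -
  \<comment> \<open>The extra \<open>b / 2\<close> cancels the \<open>sqrt m\<close> that the
    normalisation of \<open>dg_N\<close> brings in under the power \<open>- b\<close>.\<close>
  have "(\<lambda>m. real m powr (a / 2 + b / 2) * 16 powr (- b * real m)) \<longlonglongrightarrow> 0"
    using assms by real_asymp
  moreover have "(\<lambda>m. (dg_N (4 * m) * sqrt (real m) / 16 ^ m) powr (- b)) \<longlonglongrightarrow> (1 / sqrt (2 * pi)) powr (- b)"
    by (intro tendsto_powr dg_N_tendsto tendsto_const) simp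
  ultimately have "(\<lambda>m. real m powr (a / 2 + b / 2) * 16 powr (- b * real m) *
      (dg_N (4 * m) * sqrt (real m) / 16 ^ m) powr (- b)) \<longlonglongrightarrow> 0 * (1 / sqrt (2 * pi)) powr (- b)"
    by (rule tendsto_mult)
  moreover have "eventually (\<lambda>m. real m powr (a / 2 + b / 2) * 16 powr (- b * real m) *
      (dg_N (4 * m) * sqrt (real m) / 16 ^ m) powr (- b) = sqrt (real m) ^ a * dg_N (4 * m) powr (- b)) sequentially"
    using eventually_gt_at_top[of 0]
  proof eventually_elim
    case (elim m)
    have "(dg_N (4 * m) * sqrt (real m) / 16 ^ m) powr (- b) =
        dg_N (4 * m) powr (- b) * real m powr (- b / 2) * 16 powr (b * real m)"
      using elim dg_N_pos[of "4 * m"]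
      by (simp add: powr_mult powr_divide powr_powr powr_minus_divide mult.commute powr_half_sqrt[symmetric] flip: powr_realpow)
    moreover have "sqrt (real m) ^ a = real m powr (a / 2)"
      using elim by (simp add: powr_powr powr_half_sqrt[symmetric] flip: powr_realpow)
    moreover have "16 powr (- b * real m) * 16 powr (b * real m) = (1::real)"
      by (simp flip: powr_add)
    moreover have "real m powr (b / 2) * real m powr (- b / 2) = 1"
      using elim by (simp flip: powr_add)
    moreover have "real m powr (a / 2 + b / 2) * 16 powr (- b * real m) *
          (dg_N (4 * m) powr (- b) * real m powr (- b / 2) * 16 powr (b * real m)) =
        real m powr (a / 2) * dg_N (4 * m) powr (- b) *
          (16 powr (- b * real m) * 16 powr (b * real m)) * (real m powr (b / 2) * real m powr (- b / 2))"
      by (simp only: powr_add mult_ac)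
    ultimately show ?case by (simp only: mult_1_right)
  qed
  ultimately show ?thesis
    by (auto intro: Lim_transform_eventually)
qed

section \<open>Homomorphisms into the complete distance graph\<close>

lemma bij_betw_dg_V: "bij_betw (\<lambda>x. {i \<in> {..<n}. x i = 1}) (dg_V n) {A. A \<subseteq> {..<n} \<and> card A = n div 2}"
proof (rule bij_betw_byWitness[where f' = "\<lambda>A i. if i \<in> A then 1 else 0"])
  have card_eq: "card {i \<in> {..<n}. x i = 1} = (\<Sum>i<n. x i)" if "\<forall>i. x i \<in> {0, 1}" for x :: "nat \<Rightarrow> nat"
  proof -
    have "(\<Sum>i<n. x i) = (\<Sum>i<n. if x i = 1 then 1 else 0)"
      using that by (intro sum.cong) auto
    then show ?thesis by (simp add: sum.If_cases Int_def)
  qed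
  show "(\<lambda>x. {i \<in> {..<n}. x i = 1}) ` dg_V n \<subseteq> {A. A \<subseteq> {..<n} \<and> card A = n div 2}"
  proof (rule image_subsetI)
    fix x assume "x \<in> dg_V n"
    then have "\<forall>i. x i \<in> {0, 1}" "(\<Sum>i<n. x i) = n div 2" unfolding dg_V_def by blast+
    then show "{i \<in> {..<n}. x i = 1} \<in> {A. A \<subseteq> {..<n} \<and> card A = n div 2}"
      using card_eq[of x] by auto
  qed
  show "(\<lambda>A i. if i \<in> A then 1 else 0) ` {A. A \<subseteq> {..<n} \<and> card A = n div 2} \<subseteq> dg_V n"
  proof (rule image_subsetI)
    fix A assume A: "A \<in> {A. A \<subseteq> {..<n} \<and> card A = n div 2}"
    then have "{..<n} \<inter> A = A" by auto
    then show "(\<lambda>i. if i \<in> A then 1 else 0) \<in> dg_V n"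
      using A by (auto simp: dg_V_def sum.If_cases)
  qed
  show "\<forall>x\<in>dg_V n. (\<lambda>i. if i \<in> {i \<in> {..<n}. x i = 1} then 1 else 0) = x"
  proof (intro ballI ext)
    fix x i assume "x \<in> dg_V n"
    then have "x i = 0 \<or> x i = 1" "i \<ge> n \<longrightarrow> x i = 0" unfolding dg_V_def by blast+
    then show "(if i \<in> {i \<in> {..<n}. x i = 1} then 1 else 0) = x i" by auto
  qed
qed auto

lemma card_dg_V: "card (dg_V n) = n choose (n div 2)"
  using bij_betw_same_card[OF bij_betw_dg_V[of n]] by (simp add: n_subsets)

lemma real_card_dg_V: "real (card (dg_V n)) = dg_N n"
  by (simp add: card_dg_V dg_N_def)

lemma finite_dg_V: "finite (dg_V n)"
  using bij_betw_finite[OF bij_betw_dg_V[of n]] by simp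

lemma dg_V_nonempty: "dg_V n \<noteq> {}"
proof -
  have "card (dg_V n) > 0" by (simp add: card_dg_V)
  then show ?thesis by auto
qed

lemma finite_dg_E: "finite (dg_E n)"
  by (rule finite_subset[of _ "Pow (dg_V n)"]) (auto simp: dg_E_def finite_dg_V)

lemma dg_inner_commute: "dg_inner n x y = dg_inner n y x"
  by (simp add: dg_inner_def mult.commute)

lemma doubleton_in_dg_E_iff:
  assumes "x \<in> dg_V n" "y \<in> dg_V n"
  shows "{x, y} \<in> dg_E n \<longleftrightarrow> dg_inner n x y = n div 4"
  using assms dg_inner_commute by (auto simp: dg_E_def doubleton_eq_iff)

context finite_simple_graph
begin

lemma embeddings_dg: "embeddings VF EF (dg_V n) (dg_E n) = {x \<in> homs n. inj_on x VF}"
proof -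
  have "(\<forall>e\<in>EF. x ` e \<in> dg_E n) \<longleftrightarrow> (\<forall>a b. {a, b} \<in> EF \<longrightarrow> dg_inner n (x a) (x b) = n div 4)"
    if x: "x \<in> VF \<rightarrow>\<^sub>E dg_V n" for x
  proof (intro iffI allI ballI impI)
    fix a b assume "\<forall>e\<in>EF. x ` e \<in> dg_E n" and ab: "{a, b} \<in> EF"
    then have "{x a, x b} \<in> dg_E n" by force
    then show "dg_inner n (x a) (x b) = n div 4"
      using doubleton_in_dg_E_iff x edge_subset[OF ab] by (metis PiE_mem insert_subset)
  next
    fix e assume h: "\<forall>a b. {a, b} \<in> EF \<longrightarrow> dg_inner n (x a) (x b) = n div 4" and e: "e \<in> EF"
    obtain a b where ab: "a \<in> VF" "b \<in> VF" "e = {a, b}" using e by (rule edge_cases)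
    then have "dg_inner n (x a) (x b) = n div 4" using h e by blast
    then have "{x a, x b} \<in> dg_E n"
      using doubleton_in_dg_E_iff x ab by (metis PiE_mem)
    then show "x ` e \<in> dg_E n" using ab(3) by simp
  qed
  then show ?thesis unfolding embeddings_def homs_def by blast
qed

text \<open>Some pair \<open>u\<close>, \<open>v\<close> collides, and a map with
  \<open>x u = x v\<close> is determined by its values off \<open>v\<close>.\<close>

lemma card_noninjective_le:
  assumes "finite V"
  shows "card {x \<in> VF \<rightarrow>\<^sub>E V. \<not> inj_on x VF} \<le> card VF ^ 2 * card V ^ (card VF - 1)"
proof -
  let ?P = "{(u, v) \<in> VF \<times> VF. u \<noteq> v}"
  have sub: "{x \<in> VF \<rightarrow>\<^sub>E V. \<not> inj_on x VF} \<subseteq> (\<Union>(u, v)\<in>?P. {x \<in> VF \<rightarrow>\<^sub>E V. x u = x v})"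
    by (auto simp: inj_on_def)
  have finP: "finite ?P" by (rule finite_subset[of _ "VF \<times> VF"]) auto
  have finF: "finite (VF \<rightarrow>\<^sub>E V)" using assms by (intro finite_PiE) auto
  have each: "card {x \<in> VF \<rightarrow>\<^sub>E V. x u = x v} \<le> card V ^ (card VF - 1)" if uv: "u \<in> VF" "v \<in> VF" "u \<noteq> v" for u v
  proof -
    have "inj_on (\<lambda>x. restrict x (VF - {v})) {x \<in> VF \<rightarrow>\<^sub>E V. x u = x v}"
    proof (rule inj_onI)
      fix x y assume x: "x \<in> {x \<in> VF \<rightarrow>\<^sub>E V. x u = x v}" and y: "y \<in> {x \<in> VF \<rightarrow>\<^sub>E V. x u = x v}"
        and eq: "restrict x (VF - {v}) = restrict y (VF - {v})"
      have eq': "x w = y w" if "w \<in> VF - {v}" for w using fun_cong[OF eq, of w] that by simp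
      show "x = y"
      proof (rule extensionalityI[of _ VF])
        fix w assume "w \<in> VF"
        then show "x w = y w" using eq'[of w] eq'[of u] x y uv by (cases "w = v") auto
      qed (use x y in \<open>auto simp: PiE_iff\<close>)
    qed
    moreover have "(\<lambda>x. restrict x (VF - {v})) ` {x \<in> VF \<rightarrow>\<^sub>E V. x u = x v} \<subseteq> (VF - {v}) \<rightarrow>\<^sub>E V"
      by (rule image_subsetI) (simp add: restrict_PiE_iff PiE_iff)
    ultimately have "card {x \<in> VF \<rightarrow>\<^sub>E V. x u = x v} \<le> card ((VF - {v}) \<rightarrow>\<^sub>E V)"
      using assms by (intro card_inj_on_le[of "\<lambda>x. restrict x (VF - {v})"] finite_PiE) auto
    also have "\<dots> = card V ^ (card VF - 1)"
      using uv by (simp add: card_PiE)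
    finally show ?thesis .
  qed
  have "card {x \<in> VF \<rightarrow>\<^sub>E V. \<not> inj_on x VF} \<le> card (\<Union>(u, v)\<in>?P. {x \<in> VF \<rightarrow>\<^sub>E V. x u = x v})"
    by (rule card_mono[OF _ sub]) (rule finite_subset[OF _ finF], auto)
  also have "\<dots> \<le> (\<Sum>(u, v)\<in>?P. card {x \<in> VF \<rightarrow>\<^sub>E V. x u = x v})"
    using card_UN_le[OF finP, of "\<lambda>(u, v). {x \<in> VF \<rightarrow>\<^sub>E V. x u = x v}"] by (simp add: case_prod_unfold)
  also have "\<dots> \<le> (\<Sum>(u, v)\<in>?P. card V ^ (card VF - 1))"
    by (rule sum_mono) (use each in auto)
  also have "\<dots> = card ?P * card V ^ (card VF - 1)" by simp
  also have "\<dots> \<le> card VF ^ 2 * card V ^ (card VF - 1)"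
  proof (rule mult_right_mono)
    have "card ?P \<le> card (VF \<times> VF)" by (rule card_mono) auto
    then show "card ?P \<le> card VF ^ 2" by (simp add: card_cartesian_product power2_eq_square)
  qed simp
  finally show ?thesis .
qed

lemma card_homs_minus_embeddings:
  shows "card (embeddings VF EF (dg_V n) (dg_E n)) \<le> card (homs n)"
    and "real (card (homs n)) - real (card (embeddings VF EF (dg_V n) (dg_E n))) \<le>
           real (card VF ^ 2) * dg_N n ^ (card VF - 1)"
proof -
  have fin: "finite (homs n)"
    by (rule finite_subset[of _ "VF \<rightarrow>\<^sub>E dg_V n"]) (auto simp: homs_def finite_dg_V intro!: finite_PiE)
  show le: "card (embeddings VF EF (dg_V n) (dg_E n)) \<le> card (homs n)"
    unfolding embeddings_dg by (rule card_mono[OF fin]) auto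
  have "card (homs n) - card (embeddings VF EF (dg_V n) (dg_E n)) = card (homs n - {x \<in> homs n. inj_on x VF})"
    unfolding embeddings_dg by (rule card_Diff_subset[symmetric]) (auto intro: finite_subset[OF _ fin])
  also have "\<dots> \<le> card {x \<in> VF \<rightarrow>\<^sub>E dg_V n. \<not> inj_on x VF}"
    by (rule card_mono) (auto simp: homs_def finite_dg_V intro!: finite_subset[of _ "VF \<rightarrow>\<^sub>E dg_V n"] finite_PiE)
  also have "\<dots> \<le> card VF ^ 2 * card (dg_V n) ^ (card VF - 1)"
    by (rule card_noninjective_le[OF finite_dg_V])
  finally have "real (card (homs n) - card (embeddings VF EF (dg_V n) (dg_E n))) \<le>
      real (card VF ^ 2 * card (dg_V n) ^ (card VF - 1))"
    by (simp only: of_nat_le_iff)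
  then show "real (card (homs n)) - real (card (embeddings VF EF (dg_V n) (dg_E n))) \<le>
      real (card VF ^ 2) * dg_N n ^ (card VF - 1)"
    using le by (simp add: of_nat_diff real_card_dg_V)
qed

end

section \<open>Poisson convergence\<close>

text \<open>Distributing \<open>x\<close> over the falling factorial of \<open>M\<close> gives
  factors \<open>x * M - x * i\<close>, all of which tend to \<open>L\<close>.\<close>

lemma power_choose_tendsto:
  fixes x :: "nat \<Rightarrow> real" and M :: "nat \<Rightarrow> nat"
  assumes "x \<longlonglongrightarrow> 0" "(\<lambda>m. x m * real (M m)) \<longlonglongrightarrow> L"
  shows "(\<lambda>m. x m ^ r * real (M m choose r)) \<longlonglongrightarrow> L ^ r / fact r"
proof -
  have "x m ^ r * real (M m choose r) = (\<Prod>i<r. x m * real (M m) - x m * real i) / fact r" for m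
  proof -
    have "real (M m choose r) = (\<Prod>i<r. real (M m) - real i) / fact r"
      by (simp add: binomial_gbinomial gbinomial_prod_rev atLeast0LessThan)
    moreover have "(\<Prod>i<r. x m * real (M m) - x m * real i) = x m ^ r * (\<Prod>i<r. real (M m) - real i)"
      by (simp add: prod.distrib flip: right_diff_distrib)
    ultimately show ?thesis by simp
  qed
  moreover have "(\<lambda>m. (\<Prod>i<r. x m * real (M m) - x m * real i) / fact r) \<longlonglongrightarrow> (\<Prod>i<r. L - 0 * real i) / fact r"
    by (intro tendsto_intros assms) auto
  ultimately show ?thesis by simp
qed

context finite_simple_graph
begin

text \<open>The count predicted by independence: all maps into the vertex set, times the edge
  density \<open>N1 / N\<close> once per edge of \<open>F\<close>.\<close>

definition exp_homs :: "nat \<Rightarrow> real" where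
  "exp_homs m = dg_N (4 * m) ^ card VF * (dg_N1 (4 * m) / dg_N (4 * m)) ^ card EF"

lemma exp_homs_pos: "exp_homs m > 0"
  unfolding exp_homs_def by (intro mult_pos_pos zero_less_power divide_pos_pos dg_N_pos dg_N1_pos)

lemma card_homs_asymp: "(\<lambda>m. real (card (homs (4 * m))) / exp_homs m) \<longlonglongrightarrow> 1"
proof -
  let ?k = "card VF" and ?l = "card EF"
  let ?d = "\<lambda>m. dg_N1 (4 * m) / dg_N (4 * m)"
  let ?X = "\<lambda>m. real (card (homs (4 * m))) * (\<Prod>A\<in>freq. 2 * (halfwidth A * sqrt (real (4 * m)))) / 2 ^ (?k * (4 * m))"
  \<comment> \<open>The side of the box is \<open>2 * pi * sqrt m\<close> for a vertex and
    \<open>pi * sqrt m\<close> for an edge. Combined with \<open>N / 16 ^ m\<close> or the density,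
    each factor tends to \<open>sqrt (2 * pi)\<close>, the limit of one frequency in
    \<open>?X\<close>.\<close>
  let ?Y = "\<lambda>m. (2 * pi * (dg_N (4 * m) * sqrt (real m) / 16 ^ m)) ^ ?k * (pi * (sqrt (real m) * ?d m)) ^ ?l"
  have "?Y \<longlonglongrightarrow> (2 * pi * (1 / sqrt (2 * pi))) ^ ?k * (pi * sqrt (2 / pi)) ^ ?l"
    by (intro tendsto_mult tendsto_power dg_N_tendsto dg_density_tendsto tendsto_const)
  moreover have "2 * pi * (1 / sqrt (2 * pi)) = sqrt (2 * pi)"
    by (simp add: real_div_sqrt)
  moreover have "pi * sqrt (2 / pi) = sqrt (2 * pi)"
  proof -
    have "pi = sqrt pi * sqrt pi" by simp
    then show ?thesis by (simp add: real_sqrt_divide real_sqrt_mult divide_simps)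
  qed
  ultimately have Y: "?Y \<longlonglongrightarrow> sqrt (2 * pi) ^ card freq"
    by (simp only: card_freq power_add)
  have "(\<lambda>m. ?X m / ?Y m) \<longlonglongrightarrow> sqrt (2 * pi) ^ card freq / sqrt (2 * pi) ^ card freq"
    by (intro tendsto_divide card_homs_tendsto Y) simp
  then have lim: "(\<lambda>m. ?X m / ?Y m) \<longlonglongrightarrow> 1" by simp
  have eq: "?X m / ?Y m = real (card (homs (4 * m))) / exp_homs m" if m: "m > 0" for m
  proof -
    define s where "s = sqrt (real m)"
    define H where "H = real (card (homs (4 * m)))"
    define N where "N = dg_N (4 * m)"
    define d where "d = ?d m"
    have pos: "s > 0" "N > 0" "d > 0"
      using m dg_N_pos dg_N1_pos by (simp_all add: s_def N_def d_def)
    have "(\<Prod>A\<in>freq. 2 * (halfwidth A * sqrt (real (4 * m)))) = (2 * pi * s) ^ ?k * (pi * s) ^ ?l"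
      unfolding prod_freq by (simp add: halfwidth_edge real_sqrt_mult s_def power_mult_distrib)
    moreover have "(2::real) ^ (?k * (4 * m)) = (16 ^ m) ^ ?k"
    proof -
      have "(2::real) ^ (?k * (4 * m)) = ((2 ^ 4) ^ m) ^ ?k"
        by (simp only: power_mult[symmetric] mult.commute)
      then show ?thesis by simp
    qed
    ultimately have X: "?X m = H * ((2 * pi * s) ^ ?k * (pi * s) ^ ?l) / (16 ^ m) ^ ?k"
      by (simp only: H_def)
    have Y: "?Y m = ((2 * pi * s) ^ ?k * (pi * s) ^ ?l) * (N ^ ?k * d ^ ?l) / (16 ^ m) ^ ?k"
      unfolding d_def[symmetric] unfolding s_def[symmetric] N_def[symmetric]
      by (simp add: power_mult_distrib power_divide)
    have P: "(2 * pi * s) ^ ?k * (pi * s) ^ ?l > 0"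
      using pos by (intro mult_pos_pos zero_less_power) auto
    have G: "N ^ ?k * d ^ ?l = exp_homs m" by (simp add: exp_homs_def N_def d_def)
    have cancel: "H * P / q / (P * G / q) = H / G" if "P > 0" "q > 0" for P q G :: real
      using that by (simp add: field_simps)
    show ?thesis unfolding X Y G unfolding H_def[symmetric] by (rule cancel[OF P]) simp
  qed
  show ?thesis
    by (rule Lim_transform_eventually[OF lim], rule eventually_mono[OF eventually_gt_at_top[of 0]], rule eq)
qed

text \<open>The ratio equals \<open>(N / N1) ^ l / N\<close>: merging two vertices costs a factor
  \<open>N\<close>, far more than all edge densities together.\<close>

lemma power_ratio_tendsto_0:
  assumes "card VF \<ge> 1"
  shows "(\<lambda>m. dg_N (4 * m) ^ (card VF - 1) / exp_homs m) \<longlonglongrightarrow> 0"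
proof -
  let ?l = "card EF"
  let ?d = "\<lambda>m. dg_N1 (4 * m) / dg_N (4 * m)"
  have "(\<lambda>m. (sqrt (real m) ^ ?l * dg_N (4 * m) powr (- 1)) / (sqrt (real m) * ?d m) ^ ?l) \<longlonglongrightarrow> 0 / sqrt (2 / pi) ^ ?l"
    by (intro tendsto_divide tendsto_power power_dg_N_powr_tendsto_0 dg_density_tendsto) auto
  then have lim: "(\<lambda>m. (sqrt (real m) ^ ?l * dg_N (4 * m) powr (- 1)) / (sqrt (real m) * ?d m) ^ ?l) \<longlonglongrightarrow> 0"
    by (simp only: div_0)
  have eq: "(sqrt (real m) ^ ?l * dg_N (4 * m) powr (- 1)) / (sqrt (real m) * ?d m) ^ ?l =
      dg_N (4 * m) ^ (card VF - 1) / exp_homs m" if m: "m > 0" for m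
  proof -
    define N where "N = dg_N (4 * m)"
    define d where "d = ?d m"
    define s where "s = sqrt (real m) ^ ?l"
    have pos: "s > 0" "N > 0" "d > 0"
      using m dg_N_pos dg_N1_pos by (simp_all add: s_def N_def d_def)
    have "N ^ card VF = N * N ^ (card VF - 1)"
      using assms by (metis One_nat_def Suc_le_eq power_minus_mult mult.commute)
    then show ?thesis
      using pos unfolding exp_homs_def d_def[symmetric] N_def[symmetric] power_mult_distrib s_def[symmetric]
      by (simp add: powr_minus inverse_eq_divide)
  qed
  show ?thesis
    by (rule Lim_transform_eventually[OF lim], rule eventually_mono[OF eventually_gt_at_top[of 0]], rule eq)
qed

lemma card_embeddings_asymp:
  assumes "card VF \<ge> 1"
  shows "(\<lambda>m. real (card (embeddings VF EF (dg_V (4 * m)) (dg_E (4 * m)))) / exp_homs m) \<longlonglongrightarrow> 1"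
proof -
  let ?e = "\<lambda>m. real (card (embeddings VF EF (dg_V (4 * m)) (dg_E (4 * m))))"
  let ?h = "\<lambda>m. real (card (homs (4 * m)))"
  have "(\<lambda>m. ?h m / exp_homs m - ?e m / exp_homs m) \<longlonglongrightarrow> 0"
  proof (rule tendsto_sandwich[where f = "\<lambda>_. 0" and h = "\<lambda>m. real (card VF ^ 2) * (dg_N (4 * m) ^ (card VF - 1) / exp_homs m)"])
    show "eventually (\<lambda>m. 0 \<le> ?h m / exp_homs m - ?e m / exp_homs m) sequentially"
      using card_homs_minus_embeddings(1) exp_homs_pos by (simp add: divide_right_mono less_imp_le)
    show "eventually (\<lambda>m. ?h m / exp_homs m - ?e m / exp_homs m \<le> real (card VF ^ 2) * (dg_N (4 * m) ^ (card VF - 1) / exp_homs m)) sequentially"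
    proof (rule always_eventually, rule allI)
      fix m
      have "(?h m - ?e m) / exp_homs m \<le> real (card VF ^ 2) * dg_N (4 * m) ^ (card VF - 1) / exp_homs m"
        using card_homs_minus_embeddings(2) exp_homs_pos by (intro divide_right_mono) (auto intro: less_imp_le)
      then show "?h m / exp_homs m - ?e m / exp_homs m \<le> real (card VF ^ 2) * (dg_N (4 * m) ^ (card VF - 1) / exp_homs m)"
        by (simp add: diff_divide_distrib)
    qed
    show "(\<lambda>m. real (card VF ^ 2) * (dg_N (4 * m) ^ (card VF - 1) / exp_homs m)) \<longlonglongrightarrow> 0"
      using tendsto_mult_right_zero[OF power_ratio_tendsto_0[OF assms]] by simp
  qed auto
  from tendsto_diff[OF card_homs_asymp this] show ?thesis by simp
qed

lemma automorphisms_card_pos: "card (automorphisms VF EF) > 0"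
proof -
  have "finite (automorphisms VF EF)"
    by (rule finite_subset[of _ "VF \<rightarrow>\<^sub>E VF"]) (auto simp: automorphisms_def intro!: finite_PiE)
  moreover have "(\<lambda>v\<in>VF. v) \<in> automorphisms VF EF"
    by (auto simp: automorphisms_def bij_betw_def inj_on_def)
  ultimately show ?thesis by (auto simp: card_gt_0_iff)
qed

lemma exp_homs_inverse_tendsto_0:
  assumes "card VF \<ge> 1"
  shows "(\<lambda>m. 1 / exp_homs m) \<longlonglongrightarrow> 0"
proof (rule tendsto_sandwich[OF _ _ tendsto_const power_ratio_tendsto_0[OF assms]])
  show "eventually (\<lambda>m. 0 \<le> 1 / exp_homs m) sequentially"
    using exp_homs_pos by (simp add: less_imp_le)
  have "1 \<le> dg_N (4 * m)" for m
    using dg_N_pos[of "4 * m"] by (simp add: dg_N_def Suc_le_eq)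
  then show "eventually (\<lambda>m. 1 / exp_homs m \<le> dg_N (4 * m) ^ (card VF - 1) / exp_homs m) sequentially"
    using exp_homs_pos by (simp add: divide_right_mono less_imp_le)
qed

text \<open>The scaling of \<open>p\<close> is chosen so that \<open>p ^ l\<close> is asymptotic to
  \<open>c ^ l / exp_homs\<close>, while the number of copies in \<open>G\<close> is asymptotic to
  \<open>exp_homs / a\<close>.\<close>

lemma choose_moments_tendsto:
  fixes p :: "nat \<Rightarrow> real"
  assumes sb: "strictly_balanced VF EF" and l: "card EF \<ge> 1" and c: "c > 0"
    and p: "\<And>n. 0 \<le> p n \<and> p n \<le> 1"
    and asymp: "(\<lambda>m. p (4 * m)) \<sim>[sequentially]
        (\<lambda>m. c * dg_N (4 * m) powr (- real (card VF) / real (card EF)) * (dg_N (4 * m) / dg_N1 (4 * m)))"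
  shows "(\<lambda>m. measure_pmf.expectation (random_subset_pmf (dg_E (4 * m)) (p (4 * m)))
      (\<lambda>E'. real (num_copies VF EF (dg_V (4 * m)) E' choose r))) \<longlonglongrightarrow>
    (c ^ card EF / real (card (automorphisms VF EF))) ^ r / fact r"
proof -
  let ?k = "card VF" and ?l = "card EF" and ?a = "card (automorphisms VF EF)"
  let ?N = "\<lambda>m. dg_N (4 * m)" and ?d = "\<lambda>m. dg_N1 (4 * m) / dg_N (4 * m)"
  let ?M = "\<lambda>m. card (copies VF EF (dg_V (4 * m)) (dg_E (4 * m)))"
  let ?emb = "\<lambda>m. real (card (embeddings VF EF (dg_V (4 * m)) (dg_E (4 * m))))"
  define g where "g m = c * ?N m powr (- real ?k / real ?l) * (?N m / dg_N1 (4 * m))" for m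
  define \<rho> where "\<rho> m = p (4 * m) / g m" for m
  have "EF \<noteq> {}" using l by auto
  have k: "?k \<ge> 1"
  proof -
    obtain e where "e \<in> EF" using \<open>EF \<noteq> {}\<close> by blast
    then have "VF \<noteq> {}" by (auto elim: edge_cases)
    then show ?thesis by (simp add: Suc_le_eq card_gt_0_iff)
  qed
  have N: "?N m > 0" and d: "?d m > 0" for m by (simp_all add: dg_N_pos dg_N1_pos)
  have g: "g m > 0" for m
    unfolding g_def using c dg_N_pos[of "4 * m"] dg_N1_pos[of "4 * m"] by simp
  have "(\<lambda>m. if p (4 * m) = 0 \<and> g m = 0 then 1 else p (4 * m) / g m) \<longlonglongrightarrow> 1"
    using asymp unfolding asymp_equiv_def g_def[symmetric] .
  then have \<rho>: "\<rho> \<longlonglongrightarrow> 1"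
    using g by (simp add: \<rho>_def[abs_def] less_imp_neq[symmetric])
  have p_eq: "p (4 * m) = \<rho> m * c * ?N m powr (- real ?k / real ?l) / ?d m" for m
  proof -
    have "p (4 * m) = \<rho> m * g m" using g[of m] by (simp add: \<rho>_def)
    then show ?thesis by (simp add: g_def)
  qed
  have pl: "p (4 * m) ^ ?l = \<rho> m ^ ?l * c ^ ?l * (1 / exp_homs m)" for m
  proof -
    have "(?N m powr (- real ?k / real ?l)) ^ ?l = ?N m powr (- real ?k)"
      using N[of m] \<open>EF \<noteq> {}\<close> by (simp add: powr_powr flip: powr_realpow)
    also have "\<dots> = 1 / ?N m ^ ?k"
      using N[of m] by (simp add: powr_minus powr_realpow inverse_eq_divide)
    finally show ?thesis
      unfolding p_eq exp_homs_def by (simp add: power_mult_distrib power_divide)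
  qed
  have pl0: "(\<lambda>m. p (4 * m) ^ ?l) \<longlonglongrightarrow> 0"
    using tendsto_mult[OF tendsto_mult[OF tendsto_power[OF \<rho>, of ?l] tendsto_const[of "c ^ ?l"]]
        exp_homs_inverse_tendsto_0[OF k]]
    unfolding pl by simp
  have plM: "(\<lambda>m. p (4 * m) ^ ?l * real (?M m)) \<longlonglongrightarrow> c ^ ?l / real ?a"
  proof -
    have "p (4 * m) ^ ?l * real (?M m) = \<rho> m ^ ?l * (c ^ ?l / real ?a) * (?emb m / exp_homs m)" for m
      using automorphisms_card_pos card_embeddings[OF finite_dg_V finite_dg_E, of "4 * m" "4 * m"]
      unfolding pl by simp
    moreover have "(\<lambda>m. \<rho> m ^ ?l * (c ^ ?l / real ?a) * (?emb m / exp_homs m)) \<longlonglongrightarrow> 1 ^ ?l * (c ^ ?l / real ?a) * 1"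
      by (intro tendsto_mult tendsto_power \<rho> tendsto_const card_embeddings_asymp k)
    ultimately show ?thesis by simp
  qed
  have main: "(\<lambda>m. p (4 * m) ^ (r * ?l) * real (?M m choose r)) \<longlonglongrightarrow> (c ^ ?l / real ?a) ^ r / fact r"
    using power_choose_tendsto[OF pl0 plM, of r] by (simp add: mult.commute flip: power_mult)
  let ?K = "family_bound (r * ?k) * (real (r * ?k) + 1)"
  let ?err = "\<lambda>m. (1 + p (4 * m) * ?N m powr (real ?k / real ?l)) ^ (r * ?l) * ?N m powr (- 1 / real ?l)"
  have err: "?err \<longlonglongrightarrow> 0"
  proof -
    \<comment> \<open>Here \<open>p * N powr (k / l)\<close> is \<open>\<rho> * c * N / N1\<close>,
      of order \<open>sqrt m\<close>. Taking \<open>sqrt m\<close> out of the base leaves a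
      convergent factor, and \<open>N powr (- 1 / l)\<close> absorbs the power taken out.\<close>
    have "(\<lambda>m. (1 / sqrt (real m) + \<rho> m * c / (sqrt (real m) * ?d m)) ^ (r * ?l) *
        (sqrt (real m) ^ (r * ?l) * ?N m powr (- (1 / real ?l)))) \<longlonglongrightarrow> (0 + 1 * c / sqrt (2 / pi)) ^ (r * ?l) * 0"
    proof (intro tendsto_mult tendsto_power tendsto_add tendsto_divide[where a = "1 * c"] \<rho> tendsto_const
        dg_density_tendsto power_dg_N_powr_tendsto_0)
      show "(\<lambda>m. 1 / sqrt (real m)) \<longlonglongrightarrow> 0" by real_asymp
    qed (use l in auto)
    then have lim: "(\<lambda>m. (1 / sqrt (real m) + \<rho> m * c / (sqrt (real m) * ?d m)) ^ (r * ?l) *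
        (sqrt (real m) ^ (r * ?l) * ?N m powr (- (1 / real ?l)))) \<longlonglongrightarrow> 0" by simp
    have eq: "(1 / sqrt (real m) + \<rho> m * c / (sqrt (real m) * ?d m)) ^ (r * ?l) *
        (sqrt (real m) ^ (r * ?l) * ?N m powr (- (1 / real ?l))) = ?err m" if m: "m > 0" for m
    proof -
      have "p (4 * m) * ?N m powr (real ?k / real ?l) =
          \<rho> m * c / ?d m * (?N m powr (- real ?k / real ?l) * ?N m powr (real ?k / real ?l))"
        unfolding p_eq by simp
      also have "?N m powr (- real ?k / real ?l) * ?N m powr (real ?k / real ?l) = 1"
        using N[of m] by (simp flip: powr_add)
      finally have q: "p (4 * m) * ?N m powr (real ?k / real ?l) = \<rho> m * c / ?d m" by simp
      have "(1 / s + x / (s * y)) ^ j * s ^ j = (1 + x / y) ^ j" if "s > 0" for s x y :: real and j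
      proof -
        have "(1 / s + x / (s * y)) * s = 1 + x / y" using that by (simp add: distrib_right)
        then show ?thesis by (simp flip: power_mult_distrib)
      qed
      from this[of "sqrt (real m)" "\<rho> m * c" "?d m" "r * ?l"] show ?thesis
        using m unfolding q by (simp add: mult.assoc[symmetric])
    qed
    show ?thesis
      by (rule Lim_transform_eventually[OF lim], rule eventually_mono[OF eventually_gt_at_top[of 0]], rule eq)
  qed
  have "(\<lambda>m. measure_pmf.expectation (random_subset_pmf (dg_E (4 * m)) (p (4 * m)))
      (\<lambda>E'. real (num_copies VF EF (dg_V (4 * m)) E' choose r)) - p (4 * m) ^ (r * ?l) * real (?M m choose r)) \<longlonglongrightarrow> 0"
  proof (rule Lim_null_comparison)
    show "(\<lambda>m. ?K * ?err m) \<longlonglongrightarrow> 0" using tendsto_mult_right_zero[OF err] .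
    show "eventually (\<lambda>m. norm (measure_pmf.expectation (random_subset_pmf (dg_E (4 * m)) (p (4 * m)))
      (\<lambda>E'. real (num_copies VF EF (dg_V (4 * m)) E' choose r)) - p (4 * m) ^ (r * ?l) * real (?M m choose r)) \<le> ?K * ?err m) sequentially"
      using expectation_num_copies_choose_approx[OF sb l finite_dg_V dg_V_nonempty finite_dg_E] p
      by (intro always_eventually allI) (simp add: real_card_dg_V)
  qed
  from tendsto_add[OF this main] show ?thesis by simp
qed

end

theorem theorem6:
  fixes VF :: "'a set" and EF :: "'a set set" and c :: real and p :: "nat \<Rightarrow> real"
  assumes graph: "simple_graph VF EF"
    and sb: "strictly_balanced VF EF"
    and l_pos: "card EF \<ge> 1"
    and c_pos: "c > 0"
    and p_prob: "\<And>n. 0 \<le> p n \<and> p n \<le> 1"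
    and p_asymp: "(\<lambda>m. p (4 * m)) \<sim>[sequentially]
        (\<lambda>m. c * dg_N (4 * m) powr (- real (card VF) / real (card EF)) * (dg_N (4 * m) / dg_N1 (4 * m)))"
  shows "weak_conv_m
      (\<lambda>m. distr (measure_pmf (G_p (4 * m) (p (4 * m)))) borel
              (\<lambda>E'. real (num_copies VF EF (dg_V (4 * m)) E')))
      (distr (measure_pmf (poisson_pmf (c ^ card EF / real (card (automorphisms VF EF))))) borel real)"
proof -
  interpret finite_simple_graph VF EF by standard (rule graph)
  define q where "q m = map_pmf (num_copies VF EF (dg_V (4 * m))) (random_subset_pmf (dg_E (4 * m)) (p (4 * m)))" for m
  have "distr (measure_pmf (G_p (4 * m) (p (4 * m)))) borel (\<lambda>E'. real (num_copies VF EF (dg_V (4 * m)) E')) =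
      distr (measure_pmf (q m)) borel real" for m
    by (simp add: q_def G_p_def random_subset_pmf_def[symmetric] map_pmf_rep_eq distr_distr comp_def)
  moreover have "finite (set_pmf (q m))" for m
    unfolding q_def set_map_pmf using set_random_subset_pmf[of "dg_E (4 * m)"] finite_dg_E[of "4 * m"]
    by (intro finite_imageI) (auto intro: finite_subset)
  moreover have "(\<lambda>m. measure_pmf.expectation (q m) (\<lambda>x. real (x choose r))) \<longlonglongrightarrow>
      (c ^ card EF / real (card (automorphisms VF EF))) ^ r / fact r" for r
    unfolding q_def integral_map_pmf by (rule choose_moments_tendsto[OF sb l_pos c_pos p_prob p_asymp])
  moreover have "c ^ card EF / real (card (automorphisms VF EF)) > 0"
    using c_pos automorphisms_card_pos by simp
  ultimately show ?thesis
    by (simp only: weak_conv_m_poisson)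
qed

end
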